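(* Let $L$ be a hyperbolic lattice of rank $r$ and let $G$ be a subgroup of $\mathrm{O}(L)'$. Assume that $G$ is an infinite group of null-entropy, i.e. $|G|=\infty$ and $e(g)=0$ for all $g\in G$. Then: (1) There is $v\in\partial\mathcal{P}(L)\setminus\{0\}$ such that $g(v)=v$ for all $g\in G$. Moreover, the ray $\mathbf{R}_{>0}v$ in $\partial\mathcal{P}(L)$ is unique and defined over $\mathbf{Z}$; in other words, there is a unique such $v$ which is a primitive element of $L$. (2) There is a normal subgroup $G^{(0)}$ of $G$ such that $[G:G^{(0)}]<\infty$ and $G^{(0)}$ is isomorphic to a free abelian group of rank at most $r-2$. In particular, $G$ is almost abelian of rank at most $r-2$.
   Context: A lattice $L=(L,b)$ is a free abelian group $L\simeq\mathbf{Z}^r$ with a non-degenerate symmetric bilinear form $b:L\times L\to\mathbf{Z}$; $r$ is its rank. One writes $(x,y)$ for $b(x,y)$, $(x^2)$ for $b(x,x)$, and $L_K=L\otimes K$ with the extended form. The signature is the triple (numbers of positive, zero, negative eigenvalues) of the form over $\mathbf{R}$; $L$ is hyperbolic if its signature is $(1,0,r-1)$. A nonzero $v\in L$ is primitive if $L/\mathbf{Z}v$ is free. For $L$ hyperbolic, the positive cone $\mathcal{P}(L)$ is a fixed one of the two connected components of $\{x\in L_{\mathbf{R}} : (x,x)>0\}$, and $\partial\mathcal{P}(L)$ is its boundary in $L_{\mathbf{R}}$. $\mathrm{O}(L)$ is the group of isometries of $L$, and $\mathrm{O}(L)'=\{g\in \mathrm{O}(L) : g(\mathcal{P}(L))=\mathcal{P}(L)\}$.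 For $g\in\mathrm{O}(L)'$, $\delta(g)$ is the maximum of the absolute values of the eigenvalues of $g$ on $L_{\mathbf{C}}$ and $e(g):=\log\delta(g)$ is the entropy of $g$. A group $G$ is almost abelian of (finite) rank $s$ if there are a normal subgroup $G^{(0)}$ of $G$ of finite index, and a finite group $K$, which fit in an exact sequence $1\to K\to G^{(0)}\to \mathbf{Z}^s\to 0$. *)

theory Defs
  imports
    "HOL-Analysis.Analysis"
    "HOL-Algebra.Free_Abelian_Groups"
begin

text \<open>
  A lattice of rank \<open>r = CARD('n)\<close> is an abelian group \<open>'l\<close> with an additive bijection
  \<open>\<phi>\<close> onto \<open>\<int>\<^sup>r\<close> and a form \<open>b\<close>. Through \<open>\<phi>\<close>, the scalar extension of the lattice to a field
  \<open>'k\<close> is identified with \<open>'k ^ 'n\<close>. The lattice itself, its form and its isometries are not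
  coordinatized; \<open>\<phi>\<close> only serves to form scalar extensions.
\<close>

definition is_lattice ::
    "('l::ab_group_add \<Rightarrow> int ^ 'n::finite) \<Rightarrow> ('l \<Rightarrow> 'l \<Rightarrow> int) \<Rightarrow> bool" where
  "is_lattice \<phi> b \<longleftrightarrow>
     bij \<phi> \<and> Modules.additive \<phi> \<and>
     (\<forall>x y. b x y = b y x) \<and>
     (\<forall>x. Modules.additive (b x)) \<and>
     (\<forall>x. (\<forall>y. b x y = 0) \<longrightarrow> x = 0)"

definition lattice_basis :: "('l::ab_group_add \<Rightarrow> int ^ 'n::finite) \<Rightarrow> 'n \<Rightarrow> 'l" where
  "lattice_basis \<phi> i = inv_into UNIV \<phi> (axis i 1)"

definition scalar_ext ::
    "('l::ab_group_add \<Rightarrow> int ^ 'n::finite) \<Rightarrow> 'l \<Rightarrow> 'k::field ^ 'n" where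
  "scalar_ext \<phi> x = (\<chi> i. of_int (\<phi> x $ i))"

definition gram_matrix ::
    "('l::ab_group_add \<Rightarrow> int ^ 'n::finite) \<Rightarrow> ('l \<Rightarrow> 'l \<Rightarrow> int) \<Rightarrow> 'k::field ^ 'n ^ 'n" where
  "gram_matrix \<phi> b = (\<chi> i j. of_int (b (lattice_basis \<phi> i) (lattice_basis \<phi> j)))"

definition form_ext ::
    "('l::ab_group_add \<Rightarrow> int ^ 'n::finite) \<Rightarrow> ('l \<Rightarrow> 'l \<Rightarrow> int) \<Rightarrow>
     'k::field ^ 'n \<Rightarrow> 'k ^ 'n \<Rightarrow> 'k" where
  "form_ext \<phi> b x y = (\<Sum>i\<in>UNIV. \<Sum>j\<in>UNIV. x $ i * y $ j * gram_matrix \<phi> b $ i $ j)"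

definition matrix_ext ::
    "('l::ab_group_add \<Rightarrow> int ^ 'n::finite) \<Rightarrow> ('l \<Rightarrow> 'l) \<Rightarrow> 'k::field ^ 'n ^ 'n" where
  "matrix_ext \<phi> g = (\<chi> i j. of_int (\<phi> (g (lattice_basis \<phi> j)) $ i))"

definition map_ext ::
    "('l::ab_group_add \<Rightarrow> int ^ 'n::finite) \<Rightarrow> ('l \<Rightarrow> 'l) \<Rightarrow> 'k::field ^ 'n \<Rightarrow> 'k ^ 'n" where
  "map_ext \<phi> g x = matrix_ext \<phi> g *v x"

definition eigenspace :: "'k::field ^ 'n ^ 'n \<Rightarrow> 'k \<Rightarrow> ('k ^ 'n) set" where
  "eigenspace A c = {x. A *v x = c *s x}"

definition eigenvalues :: "'k::field ^ 'n ^ 'n \<Rightarrow> 'k set" where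
  "eigenvalues A = {c. \<exists>x. x \<noteq> 0 \<and> x \<in> eigenspace A c}"

text \<open>
  The eigenvalues of the form are those of its real Gram matrix, counted with multiplicity. That
  matrix is symmetric, so the multiplicity of an eigenvalue is the dimension of its eigenspace.
\<close>

definition signature ::
    "('l::ab_group_add \<Rightarrow> int ^ 'n::finite) \<Rightarrow> ('l \<Rightarrow> 'l \<Rightarrow> int) \<Rightarrow> nat \<times> nat \<times> nat" where
  "signature \<phi> b =
     (let A = (gram_matrix \<phi> b :: real ^ 'n ^ 'n); E = eigenvalues A in
       (\<Sum>c\<in>{c \<in> E. c > 0}. dim (eigenspace A c),
        \<Sum>c\<in>{c \<in> E. c = 0}. dim (eigenspace A c),
        \<Sum>c\<in>{c \<in> E. c < 0}. dim (eigenspace A c)))"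

definition hyperbolic ::
    "('l::ab_group_add \<Rightarrow> int ^ 'n::finite) \<Rightarrow> ('l \<Rightarrow> 'l \<Rightarrow> int) \<Rightarrow> bool" where
  "hyperbolic \<phi> b \<longleftrightarrow> is_lattice \<phi> b \<and> signature \<phi> b = (1, 0, CARD('n) - 1)"

definition is_positive_cone ::
    "('l::ab_group_add \<Rightarrow> int ^ 'n::finite) \<Rightarrow> ('l \<Rightarrow> 'l \<Rightarrow> int) \<Rightarrow> (real ^ 'n) set \<Rightarrow> bool" where
  "is_positive_cone \<phi> b P \<longleftrightarrow> P \<in> components {x. form_ext \<phi> b x x > 0}"

definition isometries :: "('l::ab_group_add \<Rightarrow> 'l \<Rightarrow> int) \<Rightarrow> ('l \<Rightarrow> 'l) set" where
  "isometries b = {g. bij g \<and> Modules.additive g \<and> (\<forall>x y. b (g x) (g y) = b x y)}"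

definition positive_isometry_group ::
    "('l::ab_group_add \<Rightarrow> int ^ 'n::finite) \<Rightarrow> ('l \<Rightarrow> 'l \<Rightarrow> int) \<Rightarrow> (real ^ 'n) set \<Rightarrow>
     ('l \<Rightarrow> 'l) monoid" where
  "positive_isometry_group \<phi> b P =
     \<lparr>carrier = {g \<in> isometries b. map_ext \<phi> g ` P = P}, monoid.mult = (\<circ>), one = id\<rparr>"

definition spectral_radius ::
    "('l::ab_group_add \<Rightarrow> int ^ 'n::finite) \<Rightarrow> ('l \<Rightarrow> 'l) \<Rightarrow> real" where
  "spectral_radius \<phi> g = Max (cmod ` eigenvalues (matrix_ext \<phi> g))"

definition entropy :: "('l::ab_group_add \<Rightarrow> int ^ 'n::finite) \<Rightarrow> ('l \<Rightarrow> 'l) \<Rightarrow> real" where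
  "entropy \<phi> g = ln (spectral_radius \<phi> g)"

text \<open>A basis \<open>S\<close> can be chosen inside the group, so its type is no restriction.\<close>

definition is_free_abelian :: "('a, 'm) monoid_scheme \<Rightarrow> bool" where
  "is_free_abelian A \<longleftrightarrow> (\<exists>S::'a set. A \<cong> free_Abelian_group S)"

definition additive_group :: "'l::ab_group_add monoid" where
  "additive_group = \<lparr>carrier = UNIV, monoid.mult = (+), one = 0\<rparr>"

definition primitive :: "'l::ab_group_add \<Rightarrow> bool" where
  "primitive v \<longleftrightarrow>
     v \<noteq> 0 \<and> is_free_abelian (additive_group Mod (generate additive_group {v}))"

definition fixed_boundary_vectors ::
    "('l::ab_group_add \<Rightarrow> int ^ 'n::finite) \<Rightarrow> (real ^ 'n) set \<Rightarrow> ('l \<Rightarrow> 'l) set \<Rightarrow> (real ^ 'n) set"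
  where
  "fixed_boundary_vectors \<phi> P G = {v \<in> frontier P - {0}. \<forall>g\<in>G. map_ext \<phi> g v = v}"

definition open_ray :: "'v::real_vector \<Rightarrow> 'v set" where
  "open_ray v = {c *\<^sub>R v |c. c > 0}"

text \<open>
  The exact sequence is written out because \<open>short_exact_sequence\<close> forces all groups to have
  the same element type. Taking \<open>K\<close> over the element type of \<open>G\<close> loses nothing, as \<open>K\<close> embeds in \<open>G\<close>.
\<close>

definition almost_abelian :: "('a, 'm) monoid_scheme \<Rightarrow> nat \<Rightarrow> bool" where
  "almost_abelian G s \<longleftrightarrow>
     (\<exists>N (K :: 'a monoid) f h.
        N \<lhd> G \<and> finite (rcosets\<^bsub>G\<^esub> N) \<and>
        group K \<and> finite (carrier K) \<and>
        f \<in> mon K (G\<lparr>carrier := N\<rparr>) \<and>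
        h \<in> epi (G\<lparr>carrier := N\<rparr>) (free_Abelian_group {..<s}) \<and>
        kernel (G\<lparr>carrier := N\<rparr>) (free_Abelian_group {..<s}) h = f ` carrier K)"

end

theory Submission
imports
  "Jordan_Normal_Form.Schur_Decomposition"
  Defs
begin

text \<open>
  The form makes \<open>L\<^sub>\<real>\<close> a Lorentzian space: two orthogonal vectors of non-negative norm are
  proportional. The argument rests on this fact.

  \<^emph>\<open>The fixed ray.\<close> Null entropy bounds all complex eigenvalues of \<open>g \<in> G\<close> by \<open>1\<close>, so
  \<open>\<bar>tr g\<bar> \<le> r\<close> on the whole group. As \<open>G\<close> is an infinite set of integer matrices, there are
  \<open>g\<^sub>k \<in> G\<close> with \<open>\<parallel>g\<^sub>k\<parallel> \<rightarrow> \<infinity>\<close>, and the rescaled matrices \<open>g\<^sub>k / \<parallel>g\<^sub>k\<parallel>\<close> subconverge to some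
  \<open>N \<noteq> 0\<close>. Rescaling kills the form: the image of \<open>N\<close> is totally isotropic, hence a line, and the
  same holds for the adjoint of \<open>N\<close>. Thus \<open>N x = (a, x) c\<close> with isotropic \<open>a\<close> and \<open>c\<close>. The traces
  \<open>tr (g\<^sub>k h)\<close> are bounded, so \<open>tr (N h) = (a, h c) = 0\<close> for all \<open>h \<in> G\<close>. Two orthogonal isotropic
  vectors are proportional, so every \<open>h c\<close> lies on the line of \<open>a\<close>: this line is \<open>G\<close>-invariant
  (\<open>invariant_isotropic_line\<close>). Moreover \<open>N\<close> kills all \<open>G\<close>-fixed vectors, so they are orthogonal
  to \<open>c\<close>; in particular a fixed boundary vector is a multiple of \<open>c\<close>. The eigenvalue bound for
  \<open>h\<close> and its inverse, together with the invariance of the cone, gives \<open>h c = c\<close>.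

  \<^emph>\<open>Rationality.\<close> Let \<open>f\<close> be a \<open>\<rat>\<close>-linear functional from \<open>\<real>\<close> to \<open>\<rat>\<close>, applied to the coordinates of
  \<open>c\<close>, such that \<open>x = f c\<close> is not \<open>0\<close>. Integer matrices commute with \<open>f\<close>, so the rational vector \<open>x\<close>
  is fixed by \<open>G\<close>. Hence \<open>(c, x) = 0\<close>; applying \<open>f\<close> once more, \<open>(x, x) = f (c, x) = 0\<close>. So \<open>x\<close> is
  isotropic and orthogonal to \<open>c\<close>, that is, a multiple of \<open>c\<close>. A shortest lattice vector \<open>v\<close> on the
  ray generates all lattice vectors on its line, which is what primitivity means here.

  \<^emph>\<open>The finite-index subgroup.\<close> On \<open>v\<^sup>\<bottom> / \<int>v\<close> the form is negative definite. By the
  Cauchy-Schwarz inequality, a tuple of vectors spanning \<open>v\<^sup>\<bottom>\<close> has only finitely many matrices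
  \<open>(g x\<^sub>i, x\<^sub>j)\<close>, and this matrix determines the action of \<open>g\<close> on the quotient. So the subgroup
  of \<open>g \<in> G\<close> that act trivially on \<open>v\<^sup>\<bottom> / \<int>v\<close> is normal of finite index. For such \<open>g\<close> the equation
  \<open>g x - x = \<alpha>\<^sub>x(g) v\<close> defines homomorphisms \<open>\<alpha>\<^sub>x\<close> to \<open>\<int>\<close>. An isometry that is the identity on
  \<open>v\<^sup>\<bottom>\<close> is the identity, and \<open>v\<^sup>\<bottom>\<close> has dimension \<open>r - 1\<close> and contains \<open>v\<close>, so \<open>r - 2\<close> of these
  homomorphisms are jointly injective. Finally, a group with \<open>m\<close> jointly injective
  homomorphisms to \<open>\<int>\<close> is free abelian of rank at most \<open>m\<close>
  (\<open>iso_free_Abelian_group_if_jointly_injective_homs_to_integers\<close>).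
\<close>

section \<open>Traces and eigenvalues of complex matrices\<close>

text \<open>The symbols \<open>$\<close> and \<open>\<bullet>\<close> are kept for vectors indexed by finite types.\<close>

no_notation Matrix.vec_index (infixl "$" 100)
no_notation Matrix.scalar_prod (infix "\<bullet>" 70)

lemma sum_diag_mat_mult_commute:
  fixes A B :: "'a::comm_semiring_0 mat"
  assumes A: "A \<in> carrier_mat n n" and B: "B \<in> carrier_mat n n"
  shows "(\<Sum>i<n. (A * B) $$ (i,i)) = (\<Sum>i<n. (B * A) $$ (i,i))"
proof -
  have "(\<Sum>i<n. (A * B) $$ (i,i)) = (\<Sum>i<n. \<Sum>j<n. A $$ (i,j) * B $$ (j,i))"
    using A B by (auto simp: scalar_prod_def lessThan_atLeast0 intro!: sum.cong)
  also have "\<dots> = (\<Sum>j<n. \<Sum>i<n. B $$ (j,i) * A $$ (i,j))"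
    by (subst sum.swap) (simp add: mult.commute)
  also have "\<dots> = (\<Sum>i<n. (B * A) $$ (i,i))"
    using A B by (auto simp: scalar_prod_def lessThan_atLeast0 intro!: sum.cong)
  finally show ?thesis .
qed

text \<open>
  The diagonal sum is invariant under conjugation, and the Schur decomposition puts the roots of the
  characteristic polynomial on the diagonal.
\<close>

lemma sum_diag_eq_sum_char_poly_roots:
  fixes A :: "complex mat"
  assumes A: "A \<in> carrier_mat n n" and cp: "char_poly A = (\<Prod>a\<leftarrow>as. [:- a, 1:])"
  shows "(\<Sum>i<n. A $$ (i,i)) = sum_list as"
proof -
  obtain B P Q where dec: "schur_decomposition A as = (B,P,Q)"
    by (cases "schur_decomposition A as") auto
  from schur_decomposition[OF A cp dec] have wit: "similar_mat_wit A B P Q"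
    and diag: "diag_mat B = as" by auto
  note w = similar_mat_witD2[OF A wit]
  have "(\<Sum>i<n. A $$ (i,i)) = (\<Sum>i<n. (P * (B * Q)) $$ (i,i))"
    using w by (simp add: assoc_mult_mat[of _ n n _ n _ n])
  also have "\<dots> = (\<Sum>i<n. ((B * Q) * P) $$ (i,i))"
    using w by (intro sum_diag_mat_mult_commute) auto
  also have "(B * Q) * P = B"
    using w by (simp add: assoc_mult_mat[of _ n n _ n _ n])
  also have "(\<Sum>i<n. B $$ (i,i)) = sum_list (diag_mat B)"
    using w by (simp add: diag_mat_def sum_list_sum_nth lessThan_atLeast0)
  finally show ?thesis using diag by simp
qed

text \<open>
  Matrices indexed by a finite type are transported to matrices indexed by an initial segment of
  \<open>\<nat>\<close>, where characteristic polynomials and Schur decompositions are at hand.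
\<close>

lemma obtain_mat_with_same_eigenvalues:
  fixes A :: "complex ^ 'n::finite ^ 'n"
  obtains J :: "complex mat" where "J \<in> carrier_mat CARD('n) CARD('n)"
    and "trace A = (\<Sum>i<CARD('n). J $$ (i,i))"
    and "eigenvalues A = Collect (eigenvalue J)"
proof -
  let ?n = "CARD('n)"
  obtain f :: "nat \<Rightarrow> 'n" where f: "bij_betw f {..<?n} UNIV"
    using ex_bij_betw_nat_finite[of "UNIV::'n set"] by (auto simp: atLeast0LessThan)
  define J where "J = Matrix.mat ?n ?n (\<lambda>(i,j). A $ f i $ f j)"
  have J: "J \<in> carrier_mat ?n ?n" by (simp add: J_def)
  have "trace A = (\<Sum>i<?n. A $ f i $ f i)"
    unfolding trace_def by (rule sum.reindex_bij_betw[OF f, symmetric])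
  also have "\<dots> = (\<Sum>i<?n. J $$ (i,i))" by (simp add: J_def)
  finally have tr: "trace A = (\<Sum>i<?n. J $$ (i,i))" .
  have mult: "Matrix.vec_index (J *\<^sub>v Matrix.vec ?n (\<lambda>i. x $ f i)) k = (A *v x) $ f k"
    if "k < ?n" for x k
  proof -
    have "Matrix.vec_index (J *\<^sub>v Matrix.vec ?n (\<lambda>i. x $ f i)) k = (\<Sum>j<?n. A $ f k $ f j * x $ f j)"
      using that by (simp add: J_def scalar_prod_def lessThan_atLeast0)
    also have "\<dots> = (\<Sum>j\<in>UNIV. A $ f k $ j * x $ j)"
      by (rule sum.reindex_bij_betw[OF f])
    finally show ?thesis by (simp add: matrix_vector_mult_def)
  qed
  have surj: "\<exists>k<?n. i = f k" for i
    using f unfolding bij_betw_def by auto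
  have ev: "eigenvector J (Matrix.vec ?n (\<lambda>i. x $ f i)) c \<longleftrightarrow> x \<noteq> 0 \<and> A *v x = c *s x" for x c
  proof -
    have "A *v x = c *s x \<longleftrightarrow> (\<forall>k<?n. (A *v x) $ f k = c * x $ f k)"
      unfolding vec_eq_iff using surj by (metis vector_smult_component)
    moreover have "J *\<^sub>v Matrix.vec ?n (\<lambda>i. x $ f i) = c \<cdot>\<^sub>v Matrix.vec ?n (\<lambda>i. x $ f i)
        \<longleftrightarrow> (\<forall>k<?n. (A *v x) $ f k = c * x $ f k)"
    proof -
      define u where "u = Matrix.vec ?n (\<lambda>i. x $ f i)"
      have dims: "dim_vec (J *\<^sub>v u) = ?n" "dim_vec (c \<cdot>\<^sub>v u) = ?n" using J by (auto simp: u_def)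
      have u: "Matrix.vec_index (J *\<^sub>v u) k = (A *v x) $ f k"
          "Matrix.vec_index (c \<cdot>\<^sub>v u) k = c * x $ f k" if "k < ?n" for k
        using mult[OF that] that by (simp_all only: u_def) simp
      have "J *\<^sub>v u = c \<cdot>\<^sub>v u \<longleftrightarrow>
          (\<forall>k<?n. Matrix.vec_index (J *\<^sub>v u) k = Matrix.vec_index (c \<cdot>\<^sub>v u) k)"
        by (simp only: Matrix.vec_eq_iff dims simp_thms)
      also have "\<dots> \<longleftrightarrow> (\<forall>k<?n. (A *v x) $ f k = c * x $ f k)"
        by (rule all_cong) (simp only: u)
      finally have "J *\<^sub>v u = c \<cdot>\<^sub>v u \<longleftrightarrow> (\<forall>k<?n. (A *v x) $ f k = c * x $ f k)" .
      then show ?thesis by (simp only: u_def)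
    qed
    moreover have "Matrix.vec ?n (\<lambda>i. x $ f i) = 0\<^sub>v ?n \<longleftrightarrow> x = 0"
    proof -
      have "Matrix.vec ?n (\<lambda>i. x $ f i) = 0\<^sub>v ?n \<longleftrightarrow> (\<forall>k<?n. x $ f k = 0)"
        by (simp add: Matrix.vec_eq_iff)
      also have "\<dots> \<longleftrightarrow> (\<forall>i. x $ i = 0)" using surj by metis
      finally show ?thesis by (simp add: vec_eq_iff)
    qed
    ultimately show ?thesis using J by (auto simp: eigenvector_def)
  qed
  have "eigenvalues A = Collect (eigenvalue J)"
  proof (intro equalityI subsetI)
    fix c assume "c \<in> eigenvalues A"
    then show "c \<in> Collect (eigenvalue J)"
      using ev by (auto simp: eigenvalues_def eigenspace_def eigenvalue_def)
  next
    fix c assume "c \<in> Collect (eigenvalue J)"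
    then obtain v where v: "eigenvector J v c" by (auto simp: eigenvalue_def)
    define x :: "complex ^ 'n" where "x = (\<chi> i. Matrix.vec_index v (inv_into {..<?n} f i))"
    have "v = Matrix.vec ?n (\<lambda>i. x $ f i)"
      using v J bij_betw_inv_into_left[OF f]
      by (auto simp: eigenvector_def x_def Matrix.vec_eq_iff)
    then show "c \<in> eigenvalues A"
      using v ev by (auto simp: eigenvalues_def eigenspace_def)
  qed
  then show ?thesis using that J tr by blast
qed

lemma finite_eigenvalues:
  fixes A :: "complex ^ 'n::finite ^ 'n"
  shows "finite (eigenvalues A)"
proof -
  obtain J :: "complex mat" where J: "J \<in> carrier_mat CARD('n) CARD('n)"
    and ev: "eigenvalues A = Collect (eigenvalue J)"
    using obtain_mat_with_same_eigenvalues[of A] by metis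
  have "char_poly J \<noteq> 0" using degree_monic_char_poly[OF J] by auto
  moreover have "Collect (eigenvalue J) = {c. poly (char_poly J) c = 0}"
    using eigenvalue_root_char_poly[OF J] by auto
  ultimately show ?thesis
    unfolding ev by (simp add: poly_roots_finite)
qed

lemma norm_trace_le_if_eigenvalues_le_1:
  fixes A :: "complex ^ 'n::finite ^ 'n"
  assumes "\<And>c. c \<in> eigenvalues A \<Longrightarrow> cmod c \<le> 1"
  shows "cmod (trace A) \<le> real CARD('n)"
proof -
  let ?n = "CARD('n)"
  obtain J :: "complex mat" where J: "J \<in> carrier_mat ?n ?n"
    and tr: "trace A = (\<Sum>i<?n. J $$ (i,i))" and ev: "eigenvalues A = Collect (eigenvalue J)"
    using obtain_mat_with_same_eigenvalues[of A] by metis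
  obtain as where cp: "char_poly J = (\<Prod>a\<leftarrow>as. [:- a, 1:])" and len: "length as = ?n"
    using char_poly_factorized[OF J] by auto
  have "cmod a \<le> 1" if "a \<in> set as" for a
  proof -
    have "poly (char_poly J) a = 0"
      unfolding cp poly_prod_list using that by (auto simp: prod_list_zero_iff image_iff)
    then show ?thesis using assms ev eigenvalue_root_char_poly[OF J] by auto
  qed
  then have "cmod (sum_list as) \<le> (\<Sum>a\<leftarrow>as. 1)"
    by (induction as) (auto intro!: norm_triangle_le add_mono)
  then show ?thesis
    using sum_diag_eq_sum_char_poly_roots[OF J cp] tr len by (simp add: sum_list_triv)
qed

text \<open>
  Null entropy is used only through this bound.
\<close>

lemma cmod_eigenvalue_le_1_if_entropy_0:
  assumes "entropy \<phi> g = 0" and "c \<in> eigenvalues (matrix_ext \<phi> g :: complex ^ 'n::finite ^ 'n)"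
  shows "cmod c \<le> 1"
proof -
  have le: "cmod c \<le> spectral_radius \<phi> g"
    unfolding spectral_radius_def using assms(2) finite_eigenvalues by (intro Max_ge) auto
  moreover have "spectral_radius \<phi> g \<le> 1"
  proof (rule ccontr)
    assume "\<not> ?thesis"
    then have "ln (spectral_radius \<phi> g) > 0" by (intro ln_gt_zero) auto
    then show False using assms(1) by (simp add: entropy_def)
  qed
  ultimately show ?thesis by linarith
qed

section \<open>Groups with enough homomorphisms to the integers\<close>

text \<open>
  Homomorphisms to an abelian group kill commutators.
\<close>

lemma comm_group_if_jointly_injective_homs_to_integers:
  fixes A :: "('a, 'm) monoid_scheme" (structure)
  assumes "group A" and hom: "\<And>i. i \<in> I \<Longrightarrow> h i \<in> hom A integer_group"
    and inj: "\<And>x. x \<in> carrier A \<Longrightarrow> (\<And>i. i \<in> I \<Longrightarrow> h i x = 0) \<Longrightarrow> x = \<one>"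
  shows "comm_group A"
proof -
  interpret group A by fact
  show ?thesis
  proof (rule group_comm_groupI)
    fix x y assume xy: "x \<in> carrier A" "y \<in> carrier A"
    have "h i ((x \<otimes> y) \<otimes> inv (y \<otimes> x)) = 0" if "i \<in> I" for i
    proof -
      interpret h: group_hom A integer_group "h i"
        using hom[OF that] by (simp add: group_hom_def group_hom_axioms_def)
      show ?thesis using xy by (simp add: h.hom_mult h.hom_inv)
    qed
    then have "(x \<otimes> y) \<otimes> inv (y \<otimes> x) = \<one>" using xy by (intro inj) auto
    then show "x \<otimes> y = y \<otimes> x"
      using xy by (metis inv_inv inv_equality m_closed inv_closed)
  qed
qed

text \<open>
  In other words, a subgroup of \<open>\<int>\<^sup>m\<close> is free abelian of rank at most \<open>m\<close>. Induction on the number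
  of homomorphisms: if \<open>h i\<close> is not trivial, an element \<open>a\<close> with the least positive value \<open>d = h i a\<close>
  splits off an infinite cyclic factor, since \<open>h i\<close> takes values in \<open>d\<int>\<close>; the kernel of \<open>h i\<close> is
  handled by the remaining homomorphisms. Every \<open>x\<close> is uniquely \<open>r x \<otimes> a [^] q x\<close> with \<open>r x\<close> in the
  kernel, and the new basis element \<open>s\<close> carries the coefficient \<open>q x\<close>.
\<close>

lemma iso_free_Abelian_group_if_jointly_injective_homs_to_integers:
  fixes A :: "('a, 'm) monoid_scheme"
  assumes "finite I" and "group A" and "\<And>i. i \<in> I \<Longrightarrow> h i \<in> hom A integer_group"
    and "\<And>x. x \<in> carrier A \<Longrightarrow> (\<And>i. i \<in> I \<Longrightarrow> h i x = 0) \<Longrightarrow> x = \<one>\<^bsub>A\<^esub>"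
  shows "\<exists>s\<le>card I. A \<cong> free_Abelian_group {..<s}"
  using assms
proof (induction I arbitrary: A rule: finite_induct)
  case empty
  interpret group A by fact
  have "carrier A = {\<one>\<^bsub>A\<^esub>}" using empty by auto
  moreover have "carrier (free_Abelian_group ({}::nat set)) = {0}" by auto
  ultimately have "(\<lambda>_. 0) \<in> iso A (free_Abelian_group {..<0::nat})"
    by (auto simp: iso_def hom_def bij_betw_def)
  then show ?case by (auto simp: is_iso_def)
next
  case (insert i I)
  note hom = insert.prems(2) and inj = insert.prems(3)
  interpret A: comm_group A
    by (rule comm_group_if_jointly_injective_homs_to_integers[OF insert.prems])
  interpret h: group_hom A integer_group "h i"
    using hom[of i] by (simp add: group_hom_def group_hom_axioms_def)
  show ?case
  proof (cases "\<forall>x\<in>carrier A. h i x = 0")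
    case True
    have "\<exists>s\<le>card I. A \<cong> free_Abelian_group {..<s}"
    proof (rule insert.IH[OF insert.prems(1)])
      show "h j \<in> hom A integer_group" if "j \<in> I" for j using hom that by simp
      show "x = \<one>\<^bsub>A\<^esub>" if "x \<in> carrier A" "\<And>j. j \<in> I \<Longrightarrow> h j x = 0" for x
        using inj[of x] that True by auto
    qed
    then show ?thesis using insert.hyps by (auto intro: le_SucI)
  next
    case False
    then obtain x where "x \<in> carrier A" "h i x \<noteq> 0" by auto
    then obtain y where y: "y \<in> carrier A \<and> h i y > 0"
      using h.hom_inv[of x] A.inv_closed[of x]
      by (metis int_one_le_iff_zero_less inv_integer_group linorder_neqE neg_0_less_iff_less)
    obtain a where a: "a \<in> carrier A" "h i a > 0"
      and min': "\<forall>x. x \<in> carrier A \<and> h i x > 0 \<longrightarrow> nat (h i a) \<le> nat (h i x)"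
      using ex_has_least_nat[of "\<lambda>x. x \<in> carrier A \<and> h i x > 0" y "\<lambda>x. nat (h i x)", OF y] by blast
    have min: "h i a \<le> h i x" if "x \<in> carrier A" "h i x > 0" for x
      using min' that by (metis nat_le_eq_zle order_less_imp_le)
    define d where "d = h i a"
    define q where "q x = h i x div d" for x
    define K where "K = {x \<in> carrier A. h i x = 0}"
    define r where "r x = x \<otimes>\<^bsub>A\<^esub> a [^]\<^bsub>A\<^esub> (- q x)" for x
    have h_pow: "h i (a [^]\<^bsub>A\<^esub> n) = n * d" for n :: int
      using a by (simp add: d_def h.hom_int_pow)
    have h_q: "h i x = q x * d" if "x \<in> carrier A" for x
    proof -
      have "h i (r x) = h i x mod d"
        using that a by (simp add: r_def h.hom_mult h_pow q_def minus_div_mult_eq_mod)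
      moreover have "0 \<le> h i x mod d" "h i x mod d < d" using a by (auto simp: d_def)
      moreover have "r x \<in> carrier A" using that a by (simp add: r_def)
      ultimately have "h i (r x) = 0"
        using min[of "r x"] unfolding d_def by linarith
      with \<open>h i (r x) = h i x mod d\<close> show ?thesis by (auto simp: q_def)
    qed
    have r_K: "r x \<in> K" if "x \<in> carrier A" for x
      using that a h_q[OF that] by (simp add: K_def r_def h.hom_mult h_pow)
    have q_mult: "q (x \<otimes>\<^bsub>A\<^esub> y) = q x + q y" if "x \<in> carrier A" "y \<in> carrier A" for x y
    proof -
      have "q (x \<otimes>\<^bsub>A\<^esub> y) * d = (q x + q y) * d"
        using that by (simp add: h_q[symmetric] h.hom_mult distrib_right)
      then show ?thesis using a by (simp add: d_def)
    qed
    have r_mult: "r (x \<otimes>\<^bsub>A\<^esub> y) = r x \<otimes>\<^bsub>A\<^esub> r y" if "x \<in> carrier A" "y \<in> carrier A" for x y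
    proof -
      have "a [^]\<^bsub>A\<^esub> (- (q x + q y)) = a [^]\<^bsub>A\<^esub> (- q x) \<otimes>\<^bsub>A\<^esub> a [^]\<^bsub>A\<^esub> (- q y)"
        using a by (simp flip: A.int_pow_mult)
      then show ?thesis
        using that a by (simp add: r_def q_mult A.m_ac)
    qed
    have x_eq: "x = r x \<otimes>\<^bsub>A\<^esub> a [^]\<^bsub>A\<^esub> q x" if "x \<in> carrier A" for x
      using that a by (simp add: r_def A.m_assoc flip: A.int_pow_mult)
    have "K = kernel A integer_group (h i)" by (simp add: K_def kernel_def)
    then have K: "subgroup K A" using h.subgroup_kernel by simp
    have "\<exists>s\<le>card I. A\<lparr>carrier := K\<rparr> \<cong> free_Abelian_group {..<s}"
    proof (rule insert.IH)
      show "group (A\<lparr>carrier := K\<rparr>)" by (rule A.subgroup_imp_group[OF K])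
      show "h j \<in> hom (A\<lparr>carrier := K\<rparr>) integer_group" if "j \<in> I" for j
        using hom[of j] that by (auto simp: hom_def K_def)
      show "x = \<one>\<^bsub>A\<lparr>carrier := K\<rparr>\<^esub>"
        if "x \<in> carrier (A\<lparr>carrier := K\<rparr>)" "\<And>j. j \<in> I \<Longrightarrow> h j x = 0" for x
        using inj[of x] that by (auto simp: K_def)
    qed
    then obtain s k where s: "s \<le> card I"
      and k: "k \<in> iso (A\<lparr>carrier := K\<rparr>) (free_Abelian_group {..<s})"
      by (auto simp: is_iso_def)
    have k_keys: "Poly_Mapping.keys (k x) \<subseteq> {..<s}" if "x \<in> K" for x
      using k that by (fastforce simp: iso_def hom_def)
    have k_mult: "k (x \<otimes>\<^bsub>A\<^esub> y) = k x + k y" if "x \<in> K" "y \<in> K" for x y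
      using k that by (fastforce simp: iso_def hom_def)
    have k_inj: "x = y" if "k x = k y" "x \<in> K" "y \<in> K" for x y
      using k that by (auto simp: iso_def bij_betw_def inj_on_def)
    have k_surj: "\<exists>x\<in>K. k x = F" if "Poly_Mapping.keys F \<subseteq> {..<s}" for F
    proof -
      have "k ` K = carrier (free_Abelian_group {..<s})"
        using k by (auto simp: iso_def bij_betw_def)
      moreover have "F \<in> carrier (free_Abelian_group {..<s})" using that by simp
      ultimately show ?thesis by (metis imageE)
    qed
    define f where "f x = k (r x) + frag_cmul (q x) (frag_of s)" for x
    have lookup_s: "Poly_Mapping.lookup (f x) s = q x" if "x \<in> carrier A" for x
    proof -
      have "s \<notin> Poly_Mapping.keys (k (r x))" using k_keys[OF r_K[OF that]] by auto
      then show ?thesis by (simp add: f_def lookup_add in_keys_iff)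
    qed
    have "f \<in> iso A (free_Abelian_group {..<Suc s})"
    proof (rule isoI)
      show "f \<in> hom A (free_Abelian_group {..<Suc s})"
      proof (rule homI)
        fix x assume "x \<in> carrier A"
        then have "Poly_Mapping.keys (k (r x)) \<subseteq> {..<Suc s}" using k_keys r_K by fastforce
        moreover have "Poly_Mapping.keys (frag_cmul (q x) (frag_of s)) \<subseteq> {..<Suc s}"
          using keys_cmul[of "q x" "frag_of s"] by auto
        ultimately show "f x \<in> carrier (free_Abelian_group {..<Suc s})"
          using keys_add[of "k (r x)" "frag_cmul (q x) (frag_of s)"] by (auto simp: f_def)
      next
        fix x y assume "x \<in> carrier A" "y \<in> carrier A"
        then show "f (x \<otimes>\<^bsub>A\<^esub> y) = f x \<otimes>\<^bsub>free_Abelian_group {..<Suc s}\<^esub> f y"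
          by (simp add: f_def r_mult q_mult k_mult r_K frag_cmul_distrib algebra_simps)
      qed
      show "bij_betw f (carrier A) (carrier (free_Abelian_group {..<Suc s}))"
        unfolding bij_betw_def
      proof
        show "inj_on f (carrier A)"
        proof (rule inj_onI)
          fix x y assume xy: "x \<in> carrier A" "y \<in> carrier A" and eq: "f x = f y"
          have "q x = q y" using lookup_s xy eq by metis
          moreover from this have "r x = r y" using eq k_inj r_K xy by (simp add: f_def)
          ultimately show "x = y" using x_eq xy by metis
        qed
        show "f ` carrier A = carrier (free_Abelian_group {..<Suc s})"
        proof (intro equalityI subsetI)
          fix F assume "F \<in> f ` carrier A"
          then show "F \<in> carrier (free_Abelian_group {..<Suc s})"
            using hom_carrier[OF \<open>f \<in> hom A _\<close>] by blast
        next
          fix F :: "nat \<Rightarrow>\<^sub>0 int" assume F: "F \<in> carrier (free_Abelian_group {..<Suc s})"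
          define m where "m = Poly_Mapping.lookup F s"
          have "j < s" if "j \<in> Poly_Mapping.keys (F - frag_cmul m (frag_of s))" for j
          proof -
            have "j \<noteq> s" using that by (auto simp: in_keys_iff lookup_minus m_def)
            moreover have "j \<in> Poly_Mapping.keys F"
              using that \<open>j \<noteq> s\<close> by (auto simp: in_keys_iff lookup_minus lookup_single when_def)
            ultimately show ?thesis using F by (auto simp: less_Suc_eq)
          qed
          then obtain x where x: "x \<in> K" "k x = F - frag_cmul m (frag_of s)"
            using k_surj[of "F - frag_cmul m (frag_of s)"] by blast
          define y where "y = x \<otimes>\<^bsub>A\<^esub> a [^]\<^bsub>A\<^esub> m"
          have xA: "x \<in> carrier A" "h i x = 0" using x by (auto simp: K_def)
          have y: "y \<in> carrier A" using xA a by (simp add: y_def)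
          have "q y = m" using xA a by (simp add: y_def q_def h.hom_mult h_pow d_def)
          moreover have "r y = x"
            using xA a by (simp add: r_def \<open>q y = m\<close>) (simp add: y_def A.m_assoc flip: A.int_pow_mult)
          ultimately have "f y = F" using x by (simp add: f_def)
          then show "F \<in> f ` carrier A" using y by auto
        qed
      qed
    qed
    then show ?thesis using s insert.hyps by (auto simp: is_iso_def intro!: exI[of _ "Suc s"])
  qed
qed

text \<open>
  The homomorphisms descend to the quotient by their common kernel and become jointly injective.
\<close>

lemma quotient_by_common_kernel_iso_free_Abelian_group:
  fixes A :: "('a, 'm) monoid_scheme"
  assumes "finite I" and "comm_group A" and hom: "\<And>i. i \<in> I \<Longrightarrow> h i \<in> hom A integer_group"
    and N: "subgroup N A" "N = {x \<in> carrier A. \<forall>i\<in>I. h i x = 0}"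
  shows "\<exists>s\<le>card I. A Mod N \<cong> free_Abelian_group {..<s}"
proof -
  interpret comm_group A by fact
  interpret normal N A by (rule subgroup_imp_normal[OF N(1)])
  define h' where "h' i X = the_elem (h i ` X)" for i X
  have h': "h' i (N #>\<^bsub>A\<^esub> x) = h i x" if "i \<in> I" "x \<in> carrier A" for i x
  proof -
    interpret h: group_hom A integer_group "h i"
      using hom[OF that(1)] by (simp add: group_hom_def group_hom_axioms_def)
    have "h i (n \<otimes>\<^bsub>A\<^esub> x) = h i x" if "n \<in> N" for n
    proof -
      have "n \<in> carrier A" "h i n = 0" using that N(2) \<open>i \<in> I\<close> by blast+
      then show ?thesis using \<open>x \<in> carrier A\<close> h.hom_mult[of n x] by simp
    qed
    then have "(\<lambda>n. h i (n \<otimes>\<^bsub>A\<^esub> x)) ` N = (\<lambda>_. h i x) ` N" by (rule image_cong[OF refl])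
    also have "\<dots> = {h i x}" by (rule image_constant[OF subgroup.one_closed[OF N(1)]])
    finally have "h i ` (N #>\<^bsub>A\<^esub> x) = {h i x}"
      by (simp add: r_coset_def image_image UNION_singleton_eq_range)
    then show ?thesis by (simp add: h'_def)
  qed
  show ?thesis
  proof (rule iso_free_Abelian_group_if_jointly_injective_homs_to_integers[where h = h'])
    show "finite I" by fact
    show "group (A Mod N)" by (rule factorgroup_is_group)
    show "h' i \<in> hom (A Mod N) integer_group" if "i \<in> I" for i
    proof (rule homI)
      fix X Y assume "X \<in> carrier (A Mod N)" "Y \<in> carrier (A Mod N)"
      then obtain x y where "x \<in> carrier A" "y \<in> carrier A" "X = N #>\<^bsub>A\<^esub> x" "Y = N #>\<^bsub>A\<^esub> y"
        by (auto simp: FactGroup_def RCOSETS_def)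
      then show "h' i (X \<otimes>\<^bsub>A Mod N\<^esub> Y) = h' i X \<otimes>\<^bsub>integer_group\<^esub> h' i Y"
        using that hom[OF that] by (simp add: FactGroup_def rcos_sum h' hom_def)
    qed simp
    fix X assume "X \<in> carrier (A Mod N)" and 0: "\<And>i. i \<in> I \<Longrightarrow> h' i X = 0"
    then obtain x where x: "x \<in> carrier A" "X = N #>\<^bsub>A\<^esub> x"
      by (auto simp: FactGroup_def RCOSETS_def)
    have "h i x = 0" if "i \<in> I" for i using 0[OF that] h'[OF that x(1)] x(2) by simp
    then have "x \<in> N" using N(2) x(1) by blast
    then have "N #>\<^bsub>A\<^esub> x = N" using N(1) coset_join2 x(1) by blast
    then show "X = \<one>\<^bsub>A Mod N\<^esub>" using x(2) by (simp add: FactGroup_def)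
  qed
qed

text \<open>
  A basis inside the carrier type exists as soon as that type is infinite.
\<close>

lemma is_free_abelianI:
  fixes A :: "('a, 'm) monoid_scheme"
  assumes "A \<cong> free_Abelian_group {..<s::nat}" and "infinite (UNIV :: 'a set)"
  shows "is_free_abelian A"
proof -
  obtain S :: "'a set" where "finite S" "card S = s"
    using infinite_arbitrarily_large[OF assms(2), of s] by blast
  then have "{..<s} \<approx> S" by (subst eqpoll_iff_card) auto
  then have "free_Abelian_group {..<s} \<cong> free_Abelian_group S"
    by (simp add: isomorphic_free_Abelian_groups)
  then show ?thesis
    using iso_trans[OF assms(1)] by (auto simp: is_free_abelian_def)
qed

text \<open>
  Freeness of the quotient by a vector enters the uniqueness of the primitive vector in this form.
\<close>

lemma is_free_abelian_imp_torsion_free: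
  fixes A :: "('a, 'm) monoid_scheme"
  assumes "is_free_abelian A" "group A" "x \<in> carrier A" "x [^]\<^bsub>A\<^esub> (m::int) = \<one>\<^bsub>A\<^esub>" "m \<noteq> 0"
  shows "x = \<one>\<^bsub>A\<^esub>"
proof -
  obtain S :: "'a set" and f where f: "f \<in> iso A (free_Abelian_group S)"
    using assms(1) by (auto simp: is_free_abelian_def is_iso_def)
  interpret group_hom A "free_Abelian_group S" f
    using f assms(2) by (simp add: group_hom_def group_hom_axioms_def iso_imp_homomorphism)
  have "Poly_Mapping.keys (f x) \<subseteq> S" using hom_closed[OF assms(3)] by simp
  then have "frag_cmul m (f x) = f (x [^]\<^bsub>A\<^esub> m)"
    using hom_int_pow[OF assms(3), of m] by simp
  also have "\<dots> = 0" using assms(4) hom_one by simp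
  finally have "f x = f \<one>\<^bsub>A\<^esub>" using assms(5) hom_one by simp
  then show ?thesis
    using f assms(3) by (auto simp: iso_def bij_betw_def inj_on_def)
qed

text \<open>
  A coset is determined by the value of \<open>F\<close> at any of its elements.
\<close>

lemma finite_rcosets_if_separated:
  fixes H :: "('a, 'm) monoid_scheme"
  assumes "group H" "subgroup N H" and fin: "finite (F ` carrier H)"
    and sep: "\<And>x y. x \<in> carrier H \<Longrightarrow> y \<in> carrier H \<Longrightarrow> F x = F y \<Longrightarrow> x \<otimes>\<^bsub>H\<^esub> inv\<^bsub>H\<^esub> y \<in> N"
  shows "finite (rcosets\<^bsub>H\<^esub> N)"
proof -
  interpret group H by fact
  define C where "C z = N #>\<^bsub>H\<^esub> (SOME x. x \<in> carrier H \<and> F x = z)" for z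
  have "rcosets\<^bsub>H\<^esub> N \<subseteq> C ` F ` carrier H"
  proof
    fix X assume "X \<in> rcosets\<^bsub>H\<^esub> N"
    then obtain x where x: "x \<in> carrier H" "X = N #>\<^bsub>H\<^esub> x" by (auto simp: RCOSETS_def)
    define y where "y = (SOME y. y \<in> carrier H \<and> F y = F x)"
    have y: "y \<in> carrier H \<and> F y = F x" unfolding y_def by (rule someI[of _ x]) (simp add: x)
    then have "x \<otimes>\<^bsub>H\<^esub> inv\<^bsub>H\<^esub> y \<in> N" using sep x by simp
    then have "N #>\<^bsub>H\<^esub> (x \<otimes>\<^bsub>H\<^esub> inv\<^bsub>H\<^esub> y) = N"
      using x y assms(2) by (intro coset_join2) auto
    then have "(N #>\<^bsub>H\<^esub> (x \<otimes>\<^bsub>H\<^esub> inv\<^bsub>H\<^esub> y)) #>\<^bsub>H\<^esub> y = N #>\<^bsub>H\<^esub> y" by simp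
    then have "N #>\<^bsub>H\<^esub> x = N #>\<^bsub>H\<^esub> y"
      using x y subgroup.subset[OF assms(2)] by (simp add: coset_mult_assoc m_assoc)
    then have "X = C (F x)" using x by (simp add: C_def y_def)
    then show "X \<in> C ` F ` carrier H" using x by blast
  qed
  then show ?thesis using fin by (meson finite_imageI finite_subset)
qed

text \<open>
  The trivial group serves as the finite kernel.
\<close>

lemma almost_abelian_if_free_abelian_normal_subgroup:
  fixes H :: "'a monoid"
  assumes "group H" "N \<lhd> H" "finite (rcosets\<^bsub>H\<^esub> N)" and iso: "H\<lparr>carrier := N\<rparr> \<cong> free_Abelian_group {..<s}"
  shows "almost_abelian H s"
proof -
  interpret group H by fact
  interpret normal N H by fact
  let ?N = "H\<lparr>carrier := N\<rparr>" and ?K = "H\<lparr>carrier := {\<one>\<^bsub>H\<^esub>}\<rparr>"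
  obtain h where h: "h \<in> iso ?N (free_Abelian_group {..<s})" using iso by (auto simp: is_iso_def)
  have N: "group ?N" by (rule subgroup_imp_group[OF subgroup_axioms])
  interpret h: group_hom ?N "free_Abelian_group {..<s}" h
    using h N by (simp add: group_hom_def group_hom_axioms_def iso_imp_homomorphism)
  have "kernel ?N (free_Abelian_group {..<s}) h = {\<one>\<^bsub>H\<^esub>}"
  proof (intro equalityI subsetI)
    fix x assume "x \<in> kernel ?N (free_Abelian_group {..<s}) h"
    then have "x \<in> N" "h x = h \<one>\<^bsub>H\<^esub>" using h.hom_one by (auto simp: kernel_def)
    then show "x \<in> {\<one>\<^bsub>H\<^esub>}" using h by (auto simp: iso_def bij_betw_def inj_on_def)
  next
    fix x assume "x \<in> {\<one>\<^bsub>H\<^esub>}"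
    then show "x \<in> kernel ?N (free_Abelian_group {..<s}) h" using h.hom_one by (simp add: kernel_def)
  qed
  then have ker: "kernel ?N (free_Abelian_group {..<s}) h = id ` carrier ?K" by simp
  have K: "group ?K" by (rule subgroup_imp_group[OF triv_subgroup])
  have id: "id \<in> mon ?K ?N" by (auto simp: mon_def hom_def)
  have epi: "h \<in> epi ?N (free_Abelian_group {..<s})" using h by (auto simp: epi_def iso_def bij_betw_def)
  show ?thesis
    unfolding almost_abelian_def
    by (rule exI[of _ N], rule exI[of _ ?K], rule exI[of _ id], rule exI[of _ h])
      (use K id epi ker assms in auto)
qed

section \<open>Lorentzian forms\<close>

text \<open>
  Signature \<open>(1, 0, r - 1)\<close> is used in this form: non-degeneracy and a negative definite subspace of
  codimension at most one.
\<close>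

locale lorentzian_form =
  fixes S :: "real ^ 'n::finite ^ 'n"
  assumes sym: "transpose S = S"
    and nondegenerate: "S *v x = 0 \<Longrightarrow> x = 0"
    and negative_hyperplane:
      "\<exists>N. subspace N \<and> CARD('n) \<le> dim N + 1 \<and> (\<forall>x\<in>N. x \<noteq> 0 \<longrightarrow> x \<bullet> (S *v x) < 0)"
begin

definition ip :: "real ^ 'n \<Rightarrow> real ^ 'n \<Rightarrow> real" where
  "ip x y = x \<bullet> (S *v y)"

lemma bounded_bilinear_ip: "bounded_bilinear ip"
proof -
  have "bilinear ip"
    unfolding bilinear_def ip_def
    by (auto intro!: linearI simp: inner_add_left inner_add_right matrix_vector_right_distrib
        matrix_vector_mult_scaleR)
  then show ?thesis by (simp add: bilinear_conv_bounded_bilinear)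
qed

sublocale ip: bounded_bilinear ip
  by (rule bounded_bilinear_ip)

lemma ip_commute: "ip x y = ip y x"
  unfolding ip_def by (metis dot_lmul_matrix inner_commute sym transpose_matrix_vector)

lemmas ip_simps = ip.add_left ip.add_right ip.diff_left ip.diff_right ip.scaleR_left ip.scaleR_right

text \<open>
  Otherwise the plane spanned by \<open>x\<close> and \<open>y\<close> would be positive semidefinite, and it would meet the
  negative definite hyperplane in a non-zero vector.
\<close>

lemma dependent_if_orthogonal_nonnegative:
  assumes "ip x x \<ge> 0" "ip y y \<ge> 0" "ip x y = 0"
  shows "\<exists>s t. (s \<noteq> 0 \<or> t \<noteq> 0) \<and> s *\<^sub>R x + t *\<^sub>R y = 0"
proof (rule ccontr)
  assume contra: "\<not> ?thesis"
  have "x \<noteq> 0" using contra by (metis add_0 scaleR_zero_left scaleR_zero_right zero_neq_one)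
  have "y \<noteq> k *\<^sub>R x" for k
  proof
    assume "y = k *\<^sub>R x"
    then have "(- k) *\<^sub>R x + 1 *\<^sub>R y = 0" by simp
    then show False using contra by (metis zero_neq_one)
  qed
  then have "y \<notin> span {x}" by (auto simp: span_singleton)
  then have ind: "independent {y, x}" using \<open>x \<noteq> 0\<close> by (simp add: independent_insert)
  have "y \<noteq> x" using \<open>y \<notin> span {x}\<close> span_base[of x "{x}"] by auto
  then have dim2: "dim (span {y, x}) = 2"
    using ind by (simp add: dim_eq_card_independent)
  obtain N where N: "subspace N" "CARD('n) \<le> dim N + 1" "\<And>x. x \<in> N \<Longrightarrow> x \<noteq> 0 \<Longrightarrow> x \<bullet> (S *v x) < 0"
    using negative_hyperplane by blast
  have "dim {u + v |u v. u \<in> span {y, x} \<and> v \<in> N} \<le> CARD('n)"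
    using dim_subset_UNIV[where 'a="real^'n"] by simp
  then have "dim (span {y, x} \<inter> N) \<noteq> 0"
    using dim_sums_Int[OF subspace_span N(1), of "{y, x}"] dim2 N(2) by linarith
  then obtain z where z: "z \<in> span {y, x}" "z \<in> N" "z \<noteq> 0" by (auto simp: dim_eq_0)
  then obtain s t where "z = s *\<^sub>R y + t *\<^sub>R x"
    by (auto simp: span_insert span_singleton) (metis add.commute diff_add_cancel)
  then have "ip z z = s\<^sup>2 * ip y y + t\<^sup>2 * ip x x"
    using assms(3) by (simp add: ip_simps ip_commute[of y x] power2_eq_square)
  then have "ip z z \<ge> 0" using assms by simp
  then show False using N(3) z by (force simp: ip_def)
qed

lemma ip_neg_if_orthogonal_to_positive:
  assumes "ip p p > 0" "ip p x = 0" "x \<noteq> 0"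
  shows "ip x x < 0"
proof (rule ccontr)
  assume "\<not> ?thesis"
  then obtain s t where st: "s \<noteq> 0 \<or> t \<noteq> 0" "s *\<^sub>R p + t *\<^sub>R x = 0"
    using dependent_if_orthogonal_nonnegative[of p x] assms by force
  then have "ip p (s *\<^sub>R p + t *\<^sub>R x) = 0" by (simp add: ip.zero_right)
  then have "s = 0" using assms by (simp add: ip_simps)
  then show False using st assms by auto
qed

lemma multiple_if_orthogonal_to_isotropic:
  assumes "c \<noteq> 0" "ip c c = 0" "ip c x = 0" "ip x x \<ge> 0"
  obtains t where "x = t *\<^sub>R c"
proof -
  obtain s t where st: "s \<noteq> 0 \<or> t \<noteq> 0" "s *\<^sub>R c + t *\<^sub>R x = 0"
    using dependent_if_orthogonal_nonnegative[of c x] assms by force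
  then have "t \<noteq> 0" using assms(1) by auto
  moreover have "t *\<^sub>R x = (- s) *\<^sub>R c" using st(2) by (simp add: eq_neg_iff_add_eq_0 add.commute)
  moreover have "x = (1 / t) *\<^sub>R (t *\<^sub>R x)" using \<open>t \<noteq> 0\<close> by simp
  ultimately have "x = (1 / t) *\<^sub>R ((- s) *\<^sub>R c)" by metis
  then have "x = (1 / t * - s) *\<^sub>R c" by simp
  then show thesis by (rule that)
qed

lemma ip_positive_isotropic_nonzero:
  assumes "ip p p > 0" "c \<noteq> 0" "ip c c = 0"
  shows "ip p c \<noteq> 0"
  using ip_neg_if_orthogonal_to_positive[of p c] assms by auto

text \<open>
  On \<open>c\<^sup>\<bottom>\<close> the form is negative semidefinite with radical spanned by \<open>c\<close>.
\<close>

lemma cauchy_schwarz_orthogonal_to_isotropic: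
  assumes c: "c \<noteq> 0" "ip c c = 0" and xy: "ip c x = 0" "ip c y = 0"
  shows "(ip x y)\<^sup>2 \<le> ip x x * ip y y"
proof -
  have neg: "ip z z \<le> 0" if "ip c z = 0" for z
  proof (rule ccontr)
    assume "\<not> ?thesis"
    then show False
      using ip_neg_if_orthogonal_to_positive[of z c] c that by (simp add: ip_commute)
  qed
  have *: "ip x x * (ip y y)\<^sup>2 \<le> (ip x y)\<^sup>2 * ip y y"
    using neg[of "ip y y *\<^sub>R x - ip x y *\<^sub>R y"] xy
    by (simp add: ip_simps ip_commute[of y x] power2_eq_square algebra_simps)
  show ?thesis
  proof (cases "ip y y = 0")
    case True
    then have "\<exists>t. y = t *\<^sub>R c" using multiple_if_orthogonal_to_isotropic[OF c xy(2)] by auto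
    then have "ip x y = 0" using xy(1) by (auto simp: ip_simps ip_commute[of x c])
    then show ?thesis using True by simp
  next
    case False
    then have "ip y y < 0" using neg xy(2) by force
    moreover have "(ip x x * ip y y - (ip x y)\<^sup>2) * ip y y \<le> 0"
      using * by (simp add: power2_eq_square algebra_simps)
    ultimately show ?thesis by (simp add: mult_le_0_iff)
  qed
qed

text \<open>
  A totally isotropic subspace of a Lorentzian space is at most a line.
\<close>

lemma rank_one_if_isotropic_image:
  fixes N :: "real ^ 'n ^ 'n"
  assumes "N \<noteq> 0" and iso: "\<And>x y. ip (N *v x) (N *v y) = 0"
  obtains c l where "c \<noteq> 0" "ip c c = 0" "l \<noteq> 0" "\<And>x. N *v x = (l \<bullet> x) *\<^sub>R c"
proof -
  obtain x0 where x0: "N *v x0 \<noteq> 0"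
    using assms(1) by (metis matrix_eq matrix_vector_mult_0)
  define c where "c = N *v x0"
  define l where "l = (1 / (c \<bullet> c)) *\<^sub>R (transpose N *v c)"
  have c: "c \<noteq> 0" "ip c c = 0" using x0 iso by (auto simp: c_def)
  have N: "N *v x = (l \<bullet> x) *\<^sub>R c" for x
  proof -
    have "ip c (N *v x) = 0" "ip (N *v x) (N *v x) = 0" using iso by (simp_all add: c_def)
    then obtain t where t: "N *v x = t *\<^sub>R c"
      using multiple_if_orthogonal_to_isotropic[OF c] by (metis order_refl)
    have "l \<bullet> x = (1 / (c \<bullet> c)) * (c \<bullet> (N *v x))"
      by (simp add: l_def dot_lmul_matrix)
    also have "\<dots> = t" using t c by simp
    finally show ?thesis using t by simp
  qed
  moreover have "l \<noteq> 0" using N[of x0] c by (auto simp: c_def)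
  ultimately show thesis using that c by blast
qed

end

text \<open>
  Eigenspaces of a symmetric matrix for distinct eigenvalues are orthogonal. Hence orthogonal bases
  of the eigenspaces for negative eigenvalues form together an orthogonal system of \<open>r - 1\<close> vectors,
  whose span is the negative definite hyperplane.
\<close>

lemma lorentzian_form_if_signature:
  fixes A :: "real ^ 'n::finite ^ 'n"
  assumes sym: "transpose A = A"
    and zero: "(\<Sum>c\<in>{c \<in> eigenvalues A. c = 0}. dim (eigenspace A c)) = 0"
    and neg: "(\<Sum>c\<in>{c \<in> eigenvalues A. c < 0}. dim (eigenspace A c)) = CARD('n) - 1"
  shows "lorentzian_form A"
proof
  have subsp: "subspace (eigenspace A c)" for c
    unfolding eigenspace_def
    by (auto simp: subspace_def matrix_vector_right_distrib matrix_vector_mult_scaleR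
        scalar_mult_eq_scaleR scaleR_right_distrib)
  show "transpose A = A" by (rule sym)
  show "x = 0" if "A *v x = 0" for x
  proof (rule ccontr)
    assume "x \<noteq> 0"
    have x: "x \<in> eigenspace A 0" using that by (simp add: eigenspace_def)
    then have "0 \<in> eigenvalues A" using \<open>x \<noteq> 0\<close> by (auto simp: eigenvalues_def)
    then have "{c \<in> eigenvalues A. c = 0} = {0}" by auto
    then have "dim (eigenspace A 0) = 0" using zero by simp
    then show False using x \<open>x \<noteq> 0\<close> by (auto simp: dim_eq_0)
  qed
  define E where "E = {c \<in> eigenvalues A. c < 0}"
  show "\<exists>N. subspace N \<and> CARD('n) \<le> dim N + 1 \<and> (\<forall>x\<in>N. x \<noteq> 0 \<longrightarrow> x \<bullet> (A *v x) < 0)"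
  proof (cases "finite E")
    case False
    \<comment> \<open>A sum over an infinite set is \<open>0\<close> by convention, so the signature forces rank \<open>1\<close>.\<close>
    then have "CARD('n) \<le> 1" using neg by (simp add: E_def)
    then show ?thesis by (intro exI[of _ "{0}"]) simp
  next
    case True
    have "\<exists>B. 0 \<notin> B \<and> B \<subseteq> eigenspace A c \<and> pairwise orthogonal B \<and> independent B
        \<and> card B = dim (eigenspace A c)" for c
      using orthogonal_basis_subspace[OF subsp[of c]] by metis
    then obtain B where B: "\<And>c. 0 \<notin> B c" "\<And>c. B c \<subseteq> eigenspace A c"
      "\<And>c. pairwise orthogonal (B c)" "\<And>c. independent (B c)"
      "\<And>c. card (B c) = dim (eigenspace A c)" by metis
    have finB: "finite (B c)" for c using B(4) independent_imp_finite by blast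
    have orth: "x \<bullet> y = 0" if "x \<in> eigenspace A c" "y \<in> eigenspace A d" "c \<noteq> d" for x y c d
    proof -
      have "c * (x \<bullet> y) = (A *v x) \<bullet> y" using that by (simp add: eigenspace_def scalar_mult_eq_scaleR)
      also have "\<dots> = x \<bullet> (A *v y)" by (metis dot_lmul_matrix sym transpose_matrix_vector)
      also have "\<dots> = d * (x \<bullet> y)" using that by (simp add: eigenspace_def scalar_mult_eq_scaleR)
      finally show ?thesis using that(3) by simp
    qed
    define U where "U = (\<Union>c\<in>E. B c)"
    have U: "finite U" "0 \<notin> U" using True finB B(1) by (auto simp: U_def)
    have pw: "x \<bullet> y = 0" if "x \<in> U" "y \<in> U" "x \<noteq> y" for x y
    proof -
      obtain c where "c \<in> E" "x \<in> B c" using \<open>x \<in> U\<close> unfolding U_def by blast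
      moreover obtain d where "d \<in> E" "y \<in> B d" using \<open>y \<in> U\<close> unfolding U_def by blast
      ultimately have cd: "c \<in> E" "x \<in> B c" "d \<in> E" "y \<in> B d" by auto
      show ?thesis
      proof (cases "c = d")
        case True
        then show ?thesis using B(3)[of c] cd that(3) by (auto simp: pairwise_def orthogonal_def)
      next
        case False
        then show ?thesis using orth[of x c y d] B(2) cd by auto
      qed
    qed
    then have "pairwise orthogonal U" by (auto simp: pairwise_def orthogonal_def)
    then have indU: "independent U" using U(2) by (rule pairwise_orthogonal_independent)
    have disj: "B c \<inter> B d = {}" if "c \<noteq> d" for c d
    proof (rule ccontr)
      assume "\<not> ?thesis"
      then obtain x where x: "x \<in> B c" "x \<in> B d" by blast
      then have "x \<bullet> x = 0" using orth[of x c x d] that B(2) by auto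
      then show False using x B(1) by auto
    qed
    have "card U = (\<Sum>c\<in>E. card (B c))"
      unfolding U_def using True finB disj by (intro card_UN_disjoint) auto
    then have "card U = CARD('n) - 1" using neg B(5) by (simp add: E_def)
    then have "dim (span U) = CARD('n) - 1"
      using indU by (simp add: dim_eq_card_independent)
    moreover have "x \<bullet> (A *v x) < 0" if x: "x \<in> span U" "x \<noteq> 0" for x
    proof -
      obtain t where t: "x = (\<Sum>u\<in>U. t u *\<^sub>R u)"
        using x(1) unfolding span_finite[OF U(1)] by blast
      have "\<exists>e<0. A *v u = e *\<^sub>R u" if "u \<in> U" for u
        using that B(2) by (force simp: U_def E_def eigenspace_def scalar_mult_eq_scaleR)
      then obtain e where e: "\<And>u. u \<in> U \<Longrightarrow> e u < 0" "\<And>u. u \<in> U \<Longrightarrow> A *v u = e u *\<^sub>R u"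
        by metis
      have "A *v x = (\<Sum>u\<in>U. (t u * e u) *\<^sub>R u)"
        unfolding t using e(2) by (simp add: linear_sum[OF matrix_vector_mul_linear] matrix_vector_mult_scaleR)
      then have "x \<bullet> (A *v x) = (\<Sum>u\<in>U. t u * (t u * e u * (u \<bullet> u)))"
      proof -
        have "x \<bullet> (A *v x) = (\<Sum>u\<in>U. t u * (u \<bullet> (\<Sum>w\<in>U. (t w * e w) *\<^sub>R w)))"
          unfolding \<open>A *v x = _\<close> by (subst t) (simp add: inner_sum_left)
        also have "\<dots> = (\<Sum>u\<in>U. t u * (\<Sum>w\<in>U. if w = u then t u * e u * (u \<bullet> u) else 0))"
          using pw by (intro sum.cong refl arg_cong2[where f = "(*)"])
            (auto simp: inner_sum_right intro!: sum.cong)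
        finally show ?thesis using U(1) by simp
      qed
      also have "\<dots> < 0"
      proof -
        have le: "t u * (t u * e u * (u \<bullet> u)) \<le> 0" if "u \<in> U" for u
        proof -
          have "e u * ((t u)\<^sup>2 * (u \<bullet> u)) \<le> 0"
            using e(1)[OF that] by (intro mult_nonpos_nonneg) auto
          then show ?thesis by (simp add: power2_eq_square mult_ac)
        qed
        obtain u where u: "u \<in> U" "t u \<noteq> 0"
          using x(2) t by (metis (no_types, lifting) scaleR_eq_0_iff sum.neutral)
        have "e u * ((t u)\<^sup>2 * (u \<bullet> u)) < 0"
          using e(1)[OF u(1)] u U(2) by (intro mult_neg_pos) (auto intro!: mult_pos_pos)
        then have "t u * (t u * e u * (u \<bullet> u)) < 0" by (simp add: power2_eq_square mult_ac)
        then have "(\<Sum>u\<in>U. t u * (t u * e u * (u \<bullet> u))) < (\<Sum>u\<in>U. 0)"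
          using U(1) u(1) le by (intro sum_strict_mono_ex1) auto
        then show ?thesis by simp
      qed
      finally show ?thesis .
    qed
    ultimately show ?thesis by (intro exI[of _ "span U"]) auto
  qed
qed

section \<open>Invariant isotropic lines of unbounded isometry groups\<close>

lemma finite_bounded_integer_matrices:
  "finite {A :: real ^ 'n::finite ^ 'm::finite. norm A \<le> C \<and> (\<forall>i j. A $ i $ j \<in> \<int>)}"
proof -
  let ?Z = "{x :: real. x \<in> \<int> \<and> \<bar>x\<bar> \<le> C}"
  let ?F = "\<lambda>f :: 'm \<Rightarrow> 'n \<Rightarrow> real. \<chi> i j. f i j"
  have Z: "finite ?Z" by (rule finite_abs_int_segment)
  have "{A :: real ^ 'n ^ 'm. norm A \<le> C \<and> (\<forall>i j. A $ i $ j \<in> \<int>)} \<subseteq>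
      ?F ` (UNIV \<rightarrow>\<^sub>E (UNIV \<rightarrow>\<^sub>E ?Z))"
  proof
    fix A :: "real ^ 'n ^ 'm" assume A: "A \<in> {A. norm A \<le> C \<and> (\<forall>i j. A $ i $ j \<in> \<int>)}"
    then have "\<bar>A $ i $ j\<bar> \<le> C" for i j
      using component_le_norm_cart[of "A $ i" j] Finite_Cartesian_Product.norm_nth_le[of A i] by fastforce
    then have mem: "(\<lambda>i j. A $ i $ j) \<in> UNIV \<rightarrow>\<^sub>E (UNIV \<rightarrow>\<^sub>E ?Z)" using A by auto
    have "A = ?F (\<lambda>i j. A $ i $ j)" by (simp add: vec_eq_iff)
    then show "A \<in> ?F ` (UNIV \<rightarrow>\<^sub>E (UNIV \<rightarrow>\<^sub>E ?Z))" by (rule image_eqI[OF _ mem])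
  qed
  moreover have "finite ((UNIV :: 'm set) \<rightarrow>\<^sub>E ((UNIV :: 'n set) \<rightarrow>\<^sub>E ?Z))"
    using Z by (intro finite_PiE) auto
  ultimately show ?thesis by (meson finite_imageI finite_subset)
qed


lemma ex_integer_matrix_of_large_norm:
  fixes M :: "(real ^ 'n::finite ^ 'm::finite) set"
  assumes "infinite M" and "\<And>A i j. A \<in> M \<Longrightarrow> A $ i $ j \<in> \<int>"
  shows "\<exists>A\<in>M. norm A > C"
proof (rule ccontr)
  assume "\<not> ?thesis"
  then have "M \<subseteq> {A. norm A \<le> C \<and> (\<forall>i j. A $ i $ j \<in> \<int>)}"
    using assms(2) by force
  then show False using assms(1) finite_bounded_integer_matrices finite_subset by blast
qed

lemma trace_rank_one_mult:
  fixes N H :: "real ^ 'n::finite ^ 'n"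
  assumes "\<And>x. N *v x = (l \<bullet> x) *\<^sub>R c"
  shows "trace (N ** H) = l \<bullet> (H *v c)"
proof -
  have ij: "N $ i $ j = l $ j * c $ i" for i j
  proof -
    have "N $ i $ j = (N *v axis j 1) $ i" by (simp add: matrix_vector_mult_basis column_def)
    then show ?thesis by (simp add: assms inner_axis)
  qed
  have "trace (N ** H) = (\<Sum>i\<in>UNIV. \<Sum>j\<in>UNIV. l $ j * c $ i * H $ j $ i)"
    by (simp add: trace_def matrix_matrix_mult_def ij)
  also have "\<dots> = (\<Sum>j\<in>UNIV. \<Sum>i\<in>UNIV. l $ j * (H $ j $ i * c $ i))"
    by (subst sum.swap) (simp add: mult_ac)
  also have "\<dots> = l \<bullet> (H *v c)"
    by (simp add: inner_vec_def matrix_vector_mult_def sum_distrib_left)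
  finally show ?thesis .
qed

lemma tendsto_matrix_vector_mult:
  fixes A :: "'a \<Rightarrow> real ^ 'n::finite ^ 'm::finite"
  assumes "(A \<longlongrightarrow> B) F"
  shows "((\<lambda>k. A k *v x) \<longlongrightarrow> B *v x) F"
  unfolding matrix_vector_mult_def
  by (intro vec_tendstoI) (auto intro!: tendsto_intros assms)

lemma tendsto_transpose:
  fixes A :: "'a \<Rightarrow> real ^ 'n::finite ^ 'm::finite"
  assumes "(A \<longlongrightarrow> B) F"
  shows "((\<lambda>k. transpose (A k)) \<longlongrightarrow> transpose B) F"
  unfolding transpose_def
  by (intro vec_tendstoI) (auto intro!: tendsto_intros assms)

lemma tendsto_trace_mult:
  fixes A :: "'a \<Rightarrow> real ^ 'n::finite ^ 'n"
  assumes "(A \<longlongrightarrow> B) F"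
  shows "((\<lambda>k. trace (A k ** H)) \<longlongrightarrow> trace (B ** H)) F"
  unfolding trace_def matrix_matrix_mult_def
  by (auto intro!: tendsto_intros assms)

context lorentzian_form
begin

text \<open>
  The transpose of an isometry is an isometry of the dual form, whose matrix is the inverse \<open>S'\<close>.
  The limit argument needs this to see that the functional \<open>l\<close> in \<open>N x = (l \<bullet> x) c\<close> is isotropic,
  too.
\<close>

lemma isometry_transpose:
  fixes A :: "real ^ 'n ^ 'n"
  assumes iso: "\<And>x y. ip (A *v x) (A *v y) = ip x y" and S': "S' ** S = mat 1"
  shows "(transpose A *v x) \<bullet> (S' *v (transpose A *v y)) = x \<bullet> (S' *v y)"
proof -
  have S'': "S ** S' = mat 1" using S' matrix_left_right_inverse by blast
  have "x \<bullet> (transpose A ** S ** A *v y) = x \<bullet> (S *v y)" for x y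
    using iso[of x y] unfolding ip_def
    by (metis dot_lmul_matrix matrix_vector_mul_assoc transpose_matrix_vector transpose_transpose)
  then have "transpose A ** S ** A *v y = S *v y" for y
    by (metis vector_eq_ldot)
  then have "transpose A ** S ** A = S" by (simp add: matrix_eq)
  then have "(S' ** transpose A ** S) ** A = mat 1"
    using S' by (simp add: matrix_mul_assoc[symmetric])
  then have "A ** (S' ** transpose A ** S) = mat 1" using matrix_left_right_inverse by blast
  then have "(A ** S' ** transpose A) ** (S ** S') = S'"
    by (simp add: matrix_mul_assoc)
  then have *: "A ** S' ** transpose A = S'" using S'' by simp
  have "(transpose A *v x) \<bullet> (S' *v (transpose A *v y)) = x \<bullet> (A ** S' ** transpose A *v y)"
    by (simp add: dot_lmul_matrix matrix_vector_mul_assoc[symmetric])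
  then show ?thesis by (simp add: *)
qed

text \<open>
  The heart of the proof: the normalized limit \<open>N\<close> of an unbounded sequence of isometries has the
  form \<open>N x = (a, x) c\<close> with isotropic vectors \<open>a\<close> and \<open>c\<close>, and boundedness of the traces gives
  \<open>(a, H c) = tr (N H) = 0\<close> for every \<open>H\<close> in \<open>M\<close>. As \<open>a\<close> and \<open>H c\<close> are isotropic and orthogonal,
  they are proportional.
\<close>

theorem invariant_isotropic_line:
  fixes M :: "(real ^ 'n ^ 'n) set"
  assumes "infinite M" and integer: "\<And>A i j. A \<in> M \<Longrightarrow> A $ i $ j \<in> \<int>"
    and mult: "\<And>A B. A \<in> M \<Longrightarrow> B \<in> M \<Longrightarrow> A ** B \<in> M" and one: "mat 1 \<in> M"
    and iso: "\<And>A x y. A \<in> M \<Longrightarrow> ip (A *v x) (A *v y) = ip x y"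
    and trace: "\<And>A. A \<in> M \<Longrightarrow> \<bar>trace A\<bar> \<le> C"
  obtains c where "c \<noteq> 0" "ip c c = 0" "\<And>A. A \<in> M \<Longrightarrow> \<exists>t. A *v c = t *\<^sub>R c"
    "\<And>x. (\<And>A. A \<in> M \<Longrightarrow> A *v x = x) \<Longrightarrow> ip c x = 0"
proof -
  have "\<exists>A\<in>M. norm A > real k" for k
    by (rule ex_integer_matrix_of_large_norm[OF assms(1) integer])
  then obtain A where A: "\<And>k. A k \<in> M" "\<And>k. norm (A k) > real k" by metis
  define B where "B k = (1 / norm (A k)) *\<^sub>R A k" for k
  have A_pos: "norm (A k) > 0" for k using A(2)[of k] by linarith
  then have "B k \<in> sphere 0 1" for k by (simp add: B_def)
  then obtain N r where N: "N \<in> sphere 0 1" and r: "strict_mono r" and lim: "(B \<circ> r) \<longlonglongrightarrow> N"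
    using compact_sphere[of "0 :: real ^ 'n ^ 'n" 1] unfolding compact_def by metis
  have "LIM k sequentially. norm (A k) :> at_top"
    using A(2) by (intro filterlim_at_top_mono[OF filterlim_real_sequentially]) (auto intro!: always_eventually less_imp_le)
  then have "(\<lambda>k. inverse (norm (A k))) \<longlonglongrightarrow> 0" by (rule tendsto_inverse_0_at_top)
  then have "((\<lambda>k. inverse (norm (A k))) \<circ> r) \<longlonglongrightarrow> 0" using r by (rule LIMSEQ_subseq_LIMSEQ)
  then have inv0: "(\<lambda>k. inverse (norm (A (r k)))) \<longlonglongrightarrow> 0" by (simp add: comp_def)
  have lim: "(\<lambda>k. B (r k)) \<longlonglongrightarrow> N" using lim by (simp add: comp_def)
  have Bx: "B k *v x = inverse (norm (A k)) *\<^sub>R (A k *v x)" for k x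
    by (simp add: B_def scaleR_matrix_vector_assoc divide_inverse)
  have BTx: "transpose (B k) *v x = inverse (norm (A k)) *\<^sub>R (transpose (A k) *v x)" for k x
    by (simp add: B_def transpose_scalar scaleR_matrix_vector_assoc divide_inverse
        del: transpose_matrix_vector)
  have "ip (N *v x) (N *v y) = 0" for x y
  proof (rule LIMSEQ_unique)
    show "(\<lambda>k. ip (B (r k) *v x) (B (r k) *v y)) \<longlonglongrightarrow> ip (N *v x) (N *v y)"
      by (intro ip.tendsto tendsto_matrix_vector_mult lim)
    have "(\<lambda>k. inverse (norm (A (r k))) * (inverse (norm (A (r k))) * ip x y)) \<longlonglongrightarrow> 0 * (0 * ip x y)"
      by (intro tendsto_intros inv0)
    then show "(\<lambda>k. ip (B (r k) *v x) (B (r k) *v y)) \<longlonglongrightarrow> 0"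
      by (simp add: Bx ip_simps iso A(1))
  qed
  moreover have "N \<noteq> 0" using N by auto
  ultimately obtain c l where c: "c \<noteq> 0" "ip c c = 0" and "l \<noteq> 0" and Nx: "\<And>x. N *v x = (l \<bullet> x) *\<^sub>R c"
    using rank_one_if_isotropic_image by metis
  obtain S' where S': "S' ** S = mat 1"
    using nondegenerate matrix_left_invertible_ker[of S] by blast
  then have S'': "S ** S' = mat 1" using matrix_left_right_inverse by blast
  define a where "a = S' *v l"
  have Sa: "S *v a = l" by (simp add: a_def matrix_vector_mul_assoc S'')
  have a: "a \<noteq> 0" using Sa \<open>l \<noteq> 0\<close> by auto
  have ipa: "ip a x = l \<bullet> x" for x
    using ip_commute[of a x] by (simp add: ip_def Sa inner_commute)
  have NTx: "transpose N *v x = (c \<bullet> x) *\<^sub>R l" for x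
  proof -
    have "y \<bullet> (transpose N *v x) = y \<bullet> ((c \<bullet> x) *\<^sub>R l)" for y
    proof -
      have "y \<bullet> (transpose N *v x) = (N *v y) \<bullet> x"
        by (metis dot_lmul_matrix inner_commute transpose_matrix_vector)
      then show ?thesis by (simp add: Nx inner_commute)
    qed
    then show ?thesis by (metis vector_eq_ldot)
  qed
  \<comment> \<open>Transposes of isometries preserve the dual form, so the rescaled ones shrink it to \<open>0\<close>. Hence
    \<open>l\<close> is isotropic for the dual form, which means that \<open>a\<close> is isotropic.\<close>
  have "(transpose N *v c) \<bullet> (S' *v (transpose N *v c)) = 0"
  proof (rule LIMSEQ_unique)
    show "(\<lambda>k. (transpose (B (r k)) *v c) \<bullet> (S' *v (transpose (B (r k)) *v c)))
        \<longlonglongrightarrow> (transpose N *v c) \<bullet> (S' *v (transpose N *v c))"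
      by (intro tendsto_inner tendsto_matrix_vector_mult tendsto_transpose lim
          bounded_linear.tendsto[OF matrix_vector_mul_bounded_linear])
    have "(\<lambda>k. inverse (norm (A (r k))) * (inverse (norm (A (r k))) * (c \<bullet> (S' *v c)))) \<longlonglongrightarrow> 0 * (0 * (c \<bullet> (S' *v c)))"
      by (intro tendsto_intros inv0)
    then show "(\<lambda>k. (transpose (B (r k)) *v c) \<bullet> (S' *v (transpose (B (r k)) *v c))) \<longlonglongrightarrow> 0"
      by (simp add: BTx matrix_vector_mult_scaleR isometry_transpose[OF iso[OF A(1)] S']
          del: transpose_matrix_vector)
  qed
  then have "l \<bullet> a = 0" using c
    by (simp add: NTx matrix_vector_mult_scaleR a_def del: transpose_matrix_vector)
  then have "ip a a = 0" by (simp add: ipa)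
  have line_a: "\<exists>t. H *v c = t *\<^sub>R a" if "H \<in> M" for H
  proof -
    have "trace (N ** H) = 0"
    proof (rule LIMSEQ_unique)
      show "(\<lambda>k. trace (B (r k) ** H)) \<longlonglongrightarrow> trace (N ** H)"
        by (intro tendsto_trace_mult lim)
      have bound: "norm (trace (B (r k) ** H)) \<le> inverse (norm (A (r k))) * C" for k
      proof -
        have "trace (B k ** H) = inverse (norm (A k)) * trace (A k ** H)" for k
          by (simp add: B_def trace_def matrix_matrix_mult_def sum_distrib_left divide_inverse mult_ac)
        then show ?thesis
          using trace[OF mult[OF A(1) that]] by (simp add: abs_mult mult_left_mono)
      qed
      have lim0: "(\<lambda>k. inverse (norm (A (r k))) * C) \<longlonglongrightarrow> 0"
        using tendsto_mult[OF inv0 tendsto_const[of C]] by simp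
      show "(\<lambda>k. trace (B (r k) ** H)) \<longlonglongrightarrow> 0"
        by (rule Lim_null_comparison[OF always_eventually lim0]) (intro allI bound)
    qed
    then have "ip a (H *v c) = 0" using trace_rank_one_mult[OF Nx] by (simp add: ipa)
    moreover have "ip (H *v c) (H *v c) = 0" using iso[OF that] c by simp
    ultimately show ?thesis
      using multiple_if_orthogonal_to_isotropic[OF a \<open>ip a a = 0\<close>] by (metis order_refl)
  qed
  \<comment> \<open>The identity matrix shows that \<open>c\<close> itself lies on the line of \<open>a\<close>.\<close>
  from line_a[OF one] obtain t0 where t0: "c = t0 *\<^sub>R a" by auto
  then have "t0 \<noteq> 0" using c by auto
  have "\<exists>t. H *v c = t *\<^sub>R c" if H: "H \<in> M" for H
  proof -
    obtain t where "H *v c = t *\<^sub>R a" using line_a[OF H] by blast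
    also have "\<dots> = (t / t0) *\<^sub>R c" using \<open>t0 \<noteq> 0\<close> by (simp add: t0)
    finally show ?thesis by blast
  qed
  moreover have "ip c x = 0" if fixed: "\<And>H. H \<in> M \<Longrightarrow> H *v x = x" for x
  proof -
    have "N *v x = 0"
    proof (rule LIMSEQ_unique)
      show "(\<lambda>k. B (r k) *v x) \<longlonglongrightarrow> N *v x" by (intro tendsto_matrix_vector_mult lim)
      have "(\<lambda>k. inverse (norm (A (r k))) *\<^sub>R x) \<longlonglongrightarrow> 0 *\<^sub>R x"
        by (intro tendsto_intros inv0)
      then show "(\<lambda>k. B (r k) *v x) \<longlonglongrightarrow> 0" by (simp add: Bx fixed A(1))
    qed
    then have "ip a x = 0" using c by (simp add: Nx ipa)
    then show ?thesis by (simp add: t0 ip_simps)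
  qed
  ultimately show thesis using that c by blast
qed

end

section \<open>The positive cone\<close>

locale positive_cone = lorentzian_form +
  fixes P :: "(real ^ 'a) set"
  assumes component: "P \<in> components {x. ip x x > 0}"
begin

lemma continuous_on_ip [continuous_intros]:
  assumes "continuous_on X f" "continuous_on X g"
  shows "continuous_on X (\<lambda>x. ip (f x) (g x))"
  using assms by (rule ip.continuous_on)

lemma cone_positive: "p \<in> P \<Longrightarrow> ip p p > 0"
  using in_components_subset[OF component] by auto

lemma cone_nonempty: "P \<noteq> {}"
  using in_components_nonempty[OF component] .

lemma cone_connected: "connected P"
  using in_components_connected[OF component] .

lemma open_cone: "open P"
proof (rule open_components[OF _ component])
  show "open {x. ip x x > 0}" by (intro open_Collect_less continuous_intros)
qed

lemma positive_on_cone_if_nonzero: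
  fixes f :: "real ^ 'a \<Rightarrow> real"
  assumes cont: "continuous_on P f" and nz: "\<And>x. x \<in> P \<Longrightarrow> f x \<noteq> 0"
    and pq: "p \<in> P" "f p > 0" "q \<in> P"
  shows "f q > 0"
proof (rule ccontr)
  assume "\<not> ?thesis"
  then have "0 \<in> f ` P"
    using connectedD_interval[OF connected_continuous_image[OF cont cone_connected], of "f q" "f p" 0] pq
    by auto
  then show False using nz by auto
qed

lemma ip_cone_isotropic_sign:
  assumes "c \<noteq> 0" "ip c c = 0" "p \<in> P" "ip p c > 0" "q \<in> P"
  shows "ip q c > 0"
proof (rule positive_on_cone_if_nonzero[of "\<lambda>x. ip x c"])
  show "continuous_on P (\<lambda>x. ip x c)" by (intro continuous_intros)
qed (use assms ip_positive_isotropic_nonzero cone_positive in auto)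

lemma ip_cone_cone_positive:
  assumes "p \<in> P" "q \<in> P"
  shows "ip p q > 0"
proof (rule positive_on_cone_if_nonzero[of "\<lambda>x. ip p x"])
  show "continuous_on P (\<lambda>x. ip p x)" by (intro continuous_intros)
  show "ip p x \<noteq> 0" if "x \<in> P" for x
  proof
    assume "ip p x = 0"
    moreover have "x \<noteq> 0" using cone_positive[OF that] by (auto simp: ip.zero_right)
    ultimately have "ip x x < 0"
      using ip_neg_if_orthogonal_to_positive cone_positive assms(1) by blast
    then show False using cone_positive[OF that] by simp
  qed
qed (use assms cone_positive in auto)

lemma ip_cone_closure_nonneg:
  assumes "p \<in> P" "v \<in> closure P"
  shows "ip p v \<ge> 0"
proof -
  have "closure P \<subseteq> {x. ip p x \<ge> 0}"
  proof (rule closure_minimal)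
    show "closed {x. ip p x \<ge> 0}" by (intro closed_Collect_le continuous_intros)
  qed (use ip_cone_cone_positive[OF assms(1)] in \<open>auto intro: less_imp_le\<close>)
  then show ?thesis using assms(2) by auto
qed

text \<open>
  The frontier lies in the closed set of vectors of non-negative norm. A frontier vector of positive
  norm could be added to the component \<open>P\<close> without disconnecting it.
\<close>

lemma isotropic_if_frontier:
  assumes "v \<in> frontier P"
  shows "ip v v = 0"
proof (rule ccontr)
  assume nz: "ip v v \<noteq> 0"
  have v: "v \<in> closure P" "v \<notin> P"
    using assms open_cone by (auto simp: frontier_def interior_open)
  have "closure P \<subseteq> {x. ip x x \<ge> 0}"
  proof (rule closure_minimal)
    show "closed {x. ip x x \<ge> 0}" by (intro closed_Collect_le continuous_intros)
  qed (use cone_positive in \<open>auto intro: less_imp_le\<close>)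
  then have "ip v v > 0" using v(1) nz by auto
  moreover have "connected (insert v P)"
    using v(1) by (intro connected_intermediate_closure[OF cone_connected] subset_insertI)
      (auto intro: closure_subset[THEN subsetD])
  ultimately have "insert v P \<subseteq> P"
    using components_maximal[OF component, of "insert v P"] cone_positive cone_nonempty by auto
  then show False using v(2) by auto
qed

text \<open>
  The segment from \<open>p\<close> to \<open>c + e p\<close> stays in the set of vectors of positive norm, so \<open>c + e p\<close> lies
  in the component \<open>P\<close> for every \<open>e > 0\<close>.
\<close>

lemma frontier_if_isotropic:
  assumes c: "c \<noteq> 0" "ip c c = 0" and p: "p \<in> P" "ip p c > 0"
  shows "c \<in> frontier P"
proof -
  have seg: "c + e *\<^sub>R p \<in> P" if e: "e > 0" for e :: real
  proof -
    have pos: "ip (s *\<^sub>R p + t *\<^sub>R c) (s *\<^sub>R p + t *\<^sub>R c) > 0" if "s > 0" "t \<ge> 0" for s t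
    proof -
      have "ip (s *\<^sub>R p + t *\<^sub>R c) (s *\<^sub>R p + t *\<^sub>R c) = s * s * ip p p + 2 * (s * t * ip p c)"
        using c by (simp add: ip_simps ip_commute[of c p] algebra_simps)
      moreover have "s * s * ip p p > 0" using that cone_positive[OF p(1)] by simp
      moreover have "s * t * ip p c \<ge> 0" using that p(2) by simp
      ultimately show ?thesis by linarith
    qed
    have "closed_segment p (c + e *\<^sub>R p) \<subseteq> {x. ip x x > 0}"
    proof
      fix x assume "x \<in> closed_segment p (c + e *\<^sub>R p)"
      then obtain u where u: "0 \<le> u" "u \<le> 1" "x = (1 - u) *\<^sub>R p + u *\<^sub>R (c + e *\<^sub>R p)"
        by (auto simp: closed_segment_def)
      then have "x = ((1 - u) + u * e) *\<^sub>R p + u *\<^sub>R c" by (simp add: algebra_simps)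
      moreover have "(1 - u) + u * e > 0"
      proof (cases "u = 1")
        case False
        then show ?thesis using u e by (intro add_pos_nonneg) auto
      qed (use e in simp)
      ultimately show "x \<in> {x. ip x x > 0}" using pos u(1) by simp
    qed
    then have "closed_segment p (c + e *\<^sub>R p) \<subseteq> P"
      using components_maximal[OF component connected_segment] p(1) by blast
    then show ?thesis by auto
  qed
  have "(\<lambda>k. c + inverse (real (Suc k)) *\<^sub>R p) \<longlonglongrightarrow> c + 0 *\<^sub>R p"
    by (intro tendsto_intros LIMSEQ_inverse_real_of_nat)
  then have "c \<in> closure P"
    unfolding closure_sequential using seg
    by (intro exI[of _ "\<lambda>k. c + inverse (real (Suc k)) *\<^sub>R p"]) simp
  moreover have "c \<notin> P" using cone_positive c(2) by fastforce
  ultimately show ?thesis using open_cone by (simp add: frontier_def interior_open)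
qed

lemma positive_multiple_if_frontier:
  assumes "c \<in> frontier P" "c \<noteq> 0" "v \<in> frontier P" "v \<noteq> 0" "v = t *\<^sub>R c"
  shows "t > 0"
proof -
  obtain p where p: "p \<in> P" using cone_nonempty by auto
  have "ip p x > 0" if "x \<in> frontier P" "x \<noteq> 0" for x
  proof -
    have "ip p x \<ge> 0" using that p ip_cone_closure_nonneg by (auto simp: frontier_def)
    moreover have "ip p x \<noteq> 0"
      using ip_positive_isotropic_nonzero cone_positive p isotropic_if_frontier that by blast
    ultimately show ?thesis by simp
  qed
  from this[OF assms(1,2)] this[OF assms(3,4)] show ?thesis
    using assms(5) by (simp add: ip_simps zero_less_mult_iff)
qed

end

section \<open>Lattices and their real extensions\<close>

lemma additive_on_integers:
  fixes f :: "int \<Rightarrow> int"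
  assumes "Modules.additive f"
  shows "f k = k * f 1"
proof -
  interpret Modules.additive f by fact
  have "f (int n) = int n * f 1" for n
    by (induction n) (simp_all add: zero add distrib_right)
  from this[of "nat k"] this[of "nat (- k)"] show ?thesis
    using minus[of k] by (cases "k \<ge> 0") auto
qed

locale integral_lattice =
  fixes \<phi> :: "'l::ab_group_add \<Rightarrow> int ^ 'n::finite" and b :: "'l \<Rightarrow> 'l \<Rightarrow> int"
  assumes lattice: "is_lattice \<phi> b"
begin

lemma bij_coords: "bij \<phi>"
  using lattice by (simp add: is_lattice_def)

sublocale coords: Modules.additive \<phi>
  using lattice by (simp add: is_lattice_def)

sublocale form: Modules.additive "b x"
  using lattice by (simp add: is_lattice_def)

lemma form_commute: "b x y = b y x"
  using lattice unfolding is_lattice_def by blast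

lemma coords_inject: "\<phi> x = \<phi> y \<longleftrightarrow> x = y"
  using bij_coords by (simp add: bij_def inj_eq)

lemma coords_surj: "\<exists>x. \<phi> x = v"
  using bij_coords by (metis bij_pointE)

lemma coords_basis: "\<phi> (lattice_basis \<phi> i) = axis i 1"
  unfolding lattice_basis_def by (rule f_inv_into_f) (use bij_coords in \<open>simp add: bij_def\<close>)

text \<open>
  The lattice is an abstract group without scalar multiplication, so expansions in the basis are
  stated for the values of additive functions.
\<close>

lemma additive_eq_sum_basis:
  fixes f :: "'l \<Rightarrow> int"
  assumes "Modules.additive f"
  shows "f x = (\<Sum>i\<in>UNIV. \<phi> x $ i * f (lattice_basis \<phi> i))"
proof -
  interpret f: Modules.additive f by fact
  define g where "g v = f (inv_into UNIV \<phi> v)" for v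
  have inv_add: "inv_into UNIV \<phi> (v + w) = inv_into UNIV \<phi> v + inv_into UNIV \<phi> w" for v w
    using bij_coords coords.add by (metis bij_inv_eq_iff)
  then interpret g: Modules.additive g
    by unfold_locales (simp add: g_def f.add)
  have "g (axis i k) = k * g (axis i 1)" for i k
  proof (rule additive_on_integers)
    show "Modules.additive (\<lambda>k. g (axis i k))"
    proof
      fix k l :: int
      have "axis i (k + l) = axis i k + axis i l" by (simp add: axis_def vec_eq_iff)
      then show "g (axis i (k + l)) = g (axis i k) + g (axis i l)" by (simp add: g.add)
    qed
  qed
  moreover have "\<phi> x = (\<Sum>i\<in>UNIV. axis i (\<phi> x $ i))"
    by (simp add: vec_eq_iff axis_def)
  ultimately have "g (\<phi> x) = (\<Sum>i\<in>UNIV. \<phi> x $ i * g (axis i 1))"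
    by (metis (no_types, lifting) g.sum sum.cong)
  moreover have "g (\<phi> x) = f x" using bij_coords by (simp add: g_def bij_def)
  ultimately show ?thesis by (simp add: g_def lattice_basis_def)
qed

abbreviation gram :: "real ^ 'n ^ 'n" where "gram \<equiv> gram_matrix \<phi> b"

abbreviation real_vec :: "'l \<Rightarrow> real ^ 'n" where "real_vec \<equiv> scalar_ext \<phi>"

abbreviation real_mat :: "('l \<Rightarrow> 'l) \<Rightarrow> real ^ 'n ^ 'n" where "real_mat \<equiv> matrix_ext \<phi>"

lemma real_vec_nth [simp]: "real_vec x $ i = of_int (\<phi> x $ i)"
  by (simp add: scalar_ext_def)

lemma real_vec_add: "real_vec (x + y) = real_vec x + real_vec y"
  and real_vec_diff: "real_vec (x - y) = real_vec x - real_vec y"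
  and real_vec_minus: "real_vec (- x) = - real_vec x"
  and real_vec_zero: "real_vec 0 = 0"
  by (simp_all add: vec_eq_iff coords.add coords.diff coords.minus coords.zero)

lemma real_vec_inject: "real_vec x = real_vec y \<longleftrightarrow> x = y"
  by (simp add: vec_eq_iff flip: coords_inject)

lemma real_vec_basis: "real_vec (lattice_basis \<phi> i) = axis i 1"
  by (simp add: vec_eq_iff coords_basis axis_def)

lemma form_ext_eq_inner: "form_ext \<phi> b x y = x \<bullet> (gram *v y)"
  by (simp add: form_ext_def inner_vec_def matrix_vector_mult_def sum_distrib_left mult_ac)

lemma gram_real_vec: "real_vec x \<bullet> (gram *v real_vec y) = of_int (b x y)"
proof -
  have "b x y = (\<Sum>i\<in>UNIV. \<phi> x $ i * b y (lattice_basis \<phi> i))"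
    unfolding form_commute[of x y] by (rule additive_eq_sum_basis[OF form.additive_axioms])
  also have "\<dots> = (\<Sum>i\<in>UNIV. \<phi> x $ i * (\<Sum>j\<in>UNIV. \<phi> y $ j * b (lattice_basis \<phi> i) (lattice_basis \<phi> j)))"
    by (subst form_commute[of y], subst additive_eq_sum_basis[OF form.additive_axioms, of _ y]) simp
  finally show ?thesis
    by (simp add: inner_vec_def matrix_vector_mult_def gram_matrix_def mult_ac)
qed

lemma gram_sym: "transpose gram = gram"
  by (simp add: vec_eq_iff transpose_def gram_matrix_def form_commute)

lemma real_mat_real_vec:
  assumes "Modules.additive g"
  shows "real_mat g *v real_vec x = real_vec (g x)"
proof -
  interpret g: Modules.additive g by fact
  have "\<phi> (g x) $ i = (\<Sum>j\<in>UNIV. \<phi> x $ j * \<phi> (g (lattice_basis \<phi> j)) $ i)" for i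
    by (rule additive_eq_sum_basis) (simp add: Modules.additive_def g.add coords.add)
  then show ?thesis
    by (simp add: vec_eq_iff matrix_vector_mult_def matrix_ext_def mult.commute)
qed

lemma matrix_eq_on_basis:
  fixes A B :: "real ^ 'n ^ 'n"
  assumes "\<And>x. A *v real_vec x = B *v real_vec x"
  shows "A = B"
proof -
  have "A *v axis i 1 = B *v axis i 1" for i
    using assms[of "lattice_basis \<phi> i"] by (simp add: real_vec_basis)
  then show ?thesis by (simp add: vec_eq_iff matrix_vector_mult_basis column_def)
qed

lemma real_mat_comp:
  assumes "Modules.additive g" "Modules.additive h"
  shows "real_mat (g \<circ> h) = real_mat g ** real_mat h"
proof (rule matrix_eq_on_basis)
  have "Modules.additive (g \<circ> h)" using assms by (simp add: Modules.additive_def)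
  then show "real_mat (g \<circ> h) *v real_vec x = (real_mat g ** real_mat h) *v real_vec x" for x
    by (simp add: real_mat_real_vec assms flip: matrix_vector_mul_assoc)
qed

lemma real_mat_id: "real_mat id = mat 1"
proof (rule matrix_eq_on_basis)
  have "Modules.additive (id :: 'l \<Rightarrow> 'l)" by (simp add: Modules.additive_def)
  then show "real_mat id *v real_vec x = mat 1 *v real_vec x" for x
    by (simp add: real_mat_real_vec)
qed

lemma real_mat_inject:
  assumes "Modules.additive g" "Modules.additive h" "real_mat g = real_mat h"
  shows "g = h"
proof
  fix x
  have "real_vec (g x) = real_vec (h x)"
    using assms by (metis real_mat_real_vec)
  then show "g x = h x" by (simp add: real_vec_inject)
qed

lemma real_mat_isometry:
  assumes "g \<in> isometries b"
  shows "(real_mat g *v x) \<bullet> (gram *v (real_mat g *v y)) = x \<bullet> (gram *v y)"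
proof -
  have g: "Modules.additive g" "\<And>x y. b (g x) (g y) = b x y"
    using assms by (auto simp: isometries_def)
  have "(\<lambda>x y. (real_mat g *v x) \<bullet> (gram *v (real_mat g *v y))) = (\<lambda>x y. x \<bullet> (gram *v y))"
  proof (rule bilinear_eq_stdbasis)
    show "bilinear (\<lambda>x y. (real_mat g *v x) \<bullet> (gram *v (real_mat g *v y)))"
      "bilinear (\<lambda>x y. x \<bullet> (gram *v y))"
      unfolding bilinear_def
      by (auto intro!: linearI simp: inner_add_left inner_add_right matrix_vector_right_distrib
          matrix_vector_mult_scaleR)
  next
    fix i j :: "real ^ 'n" assume "i \<in> Basis" "j \<in> Basis"
    then obtain k l where "i = real_vec (lattice_basis \<phi> k)" "j = real_vec (lattice_basis \<phi> l)"
      by (auto simp: Basis_vec_def real_vec_basis)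
    then show "(real_mat g *v i) \<bullet> (gram *v (real_mat g *v j)) = i \<bullet> (gram *v j)"
      by (simp only: real_mat_real_vec[OF g(1)] gram_real_vec g(2))
  qed
  then show ?thesis by metis
qed

end

locale hyperbolic_lattice = integral_lattice \<phi> b
  for \<phi> :: "'l::ab_group_add \<Rightarrow> int ^ 'n::finite" and b +
  fixes P :: "(real ^ 'n) set"
  assumes hyperbolic: "hyperbolic \<phi> b" and cone: "is_positive_cone \<phi> b P"
begin

sublocale positive_cone gram P
proof -
  have "lorentzian_form gram"
    using hyperbolic lorentzian_form_if_signature[OF gram_sym]
    by (simp add: hyperbolic_def signature_def Let_def)
  then interpret lorentzian_form gram .
  show "positive_cone gram P"
    by unfold_locales (use cone in \<open>simp add: is_positive_cone_def form_ext_eq_inner ip_def\<close>)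
qed

lemma ip_real_vec: "ip (real_vec x) (real_vec y) = of_int (b x y)"
  by (simp add: ip_def gram_real_vec)

end

section \<open>Primitive vectors\<close>

lemma comm_group_additive_group: "comm_group (additive_group :: 'l::ab_group_add monoid)"
proof (rule comm_groupI)
  fix x :: 'l assume "x \<in> carrier additive_group"
  show "\<exists>y\<in>carrier additive_group. y \<otimes>\<^bsub>additive_group\<^esub> x = \<one>\<^bsub>additive_group\<^esub>"
    by (rule bexI[of _ "- x"]) (simp_all add: additive_group_def)
qed (simp_all add: additive_group_def algebra_simps)

context integral_lattice
begin

lemma hom_additive_groupI:
  fixes f :: "'l \<Rightarrow> int"
  assumes "\<And>x y. f (x + y) = f x + f y"
  shows "f \<in> hom additive_group integer_group"
  using assms by (simp add: hom_def additive_group_def)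

lemma coords_int_pow: "\<phi> (x [^]\<^bsub>additive_group\<^esub> (k::int)) $ i = k * \<phi> x $ i"
proof -
  have "(\<lambda>x. \<phi> x $ i) \<in> hom additive_group integer_group"
    by (rule hom_additive_groupI) (simp add: coords.add)
  then interpret group_hom additive_group integer_group "\<lambda>x. \<phi> x $ i"
    using comm_group_additive_group[where 'l = 'l]
    by (simp add: group_hom_def group_hom_axioms_def comm_group_def)
  have "x \<in> carrier additive_group" by (simp add: additive_group_def)
  from hom_int_pow[OF this, of k] show ?thesis by simp
qed

lemma real_vec_int_pow: "real_vec (x [^]\<^bsub>additive_group\<^esub> (k::int)) = of_int k *\<^sub>R real_vec x"
  by (simp add: vec_eq_iff coords_int_pow)

lemma int_pow_additive_group_eq_iff:
  "y = x [^]\<^bsub>additive_group\<^esub> (k::int) \<longleftrightarrow> real_vec y = of_int k *\<^sub>R real_vec x"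
  by (metis real_vec_int_pow real_vec_inject)

text \<open>
  Membership in \<open>\<int>x\<close> is expressed through real multiples of the coordinate vector, the form in which
  it is used below.
\<close>

lemma generate_additive_group:
  "generate additive_group {x} = {y. \<exists>k::int. real_vec y = of_int k *\<^sub>R real_vec x}"
proof -
  interpret comm_group "additive_group :: 'l monoid" by (rule comm_group_additive_group)
  have "generate additive_group {x} = {x [^]\<^bsub>additive_group\<^esub> (k::int) | k. k \<in> UNIV}"
    by (rule generate_pow) (simp add: additive_group_def)
  then show ?thesis by (auto simp: int_pow_additive_group_eq_iff)
qed

text \<open>
  The minors \<open>v\<^sub>i x\<^sub>j - v\<^sub>j x\<^sub>i\<close> vanish simultaneously exactly when \<open>x\<close> is a real multiple of \<open>v\<close>, which
  by saturation means \<open>x \<in> \<int>v\<close>. So the quotient by \<open>\<int>v\<close> has finitely many jointly injective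
  homomorphisms to \<open>\<int>\<close>.
\<close>

lemma primitive_if_saturated:
  assumes "v \<noteq> 0"
    and sat: "\<And>x t. real_vec x = t *\<^sub>R real_vec v \<Longrightarrow> \<exists>k::int. real_vec x = of_int k *\<^sub>R real_vec v"
  shows "primitive v"
proof -
  let ?A = "additive_group :: 'l monoid"
  interpret comm_group ?A by (rule comm_group_additive_group)
  define N where "N = generate ?A {v}"
  define h where "h p x = \<phi> v $ fst p * \<phi> x $ snd p - \<phi> v $ snd p * \<phi> x $ fst p" for p :: "'n \<times> 'n" and x
  have "\<exists>s\<le>card (UNIV :: ('n \<times> 'n) set). ?A Mod N \<cong> free_Abelian_group {..<s}"
  proof (rule quotient_by_common_kernel_iso_free_Abelian_group[where h = h])
    show "comm_group ?A" by (rule comm_group_additive_group)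
    show "h p \<in> hom ?A integer_group" for p
      by (rule hom_additive_groupI) (simp add: h_def coords.add algebra_simps)
    show "subgroup N ?A"
      unfolding N_def by (rule generate_is_subgroup) (simp add: additive_group_def)
    show "N = {x \<in> carrier ?A. \<forall>p\<in>UNIV. h p x = 0}"
    proof (intro equalityI subsetI)
      fix x assume "x \<in> N"
      then obtain k :: int where "x = v [^]\<^bsub>additive_group\<^esub> k"
        by (auto simp: N_def generate_additive_group int_pow_additive_group_eq_iff)
      then show "x \<in> {x \<in> carrier ?A. \<forall>p\<in>UNIV. h p x = 0}"
        by (simp add: additive_group_def h_def coords_int_pow[unfolded additive_group_def])
    next
      fix x assume "x \<in> {x \<in> carrier ?A. \<forall>p\<in>UNIV. h p x = 0}"
      then have h0: "h (i, j) x = 0" for i j by auto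
      obtain i where i: "\<phi> v $ i \<noteq> 0"
        using assms(1) coords_inject[of v 0] by (auto simp: vec_eq_iff coords.zero)
      have "real_vec x = (of_int (\<phi> x $ i) / of_int (\<phi> v $ i)) *\<^sub>R real_vec v"
      proof (subst vec_eq_iff, rule allI)
        fix j
        have "\<phi> v $ i * \<phi> x $ j = \<phi> x $ i * \<phi> v $ j" using h0[of i j] by (simp add: h_def mult.commute)
        then have "real_of_int (\<phi> v $ i) * real_of_int (\<phi> x $ j) = of_int (\<phi> x $ i) * of_int (\<phi> v $ j)"
          by (metis of_int_mult)
        then show "real_vec x $ j = ((of_int (\<phi> x $ i) / of_int (\<phi> v $ i)) *\<^sub>R real_vec v) $ j"
          using i by (simp add: field_simps)
      qed
      then show "x \<in> N" using sat by (simp add: N_def generate_additive_group)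
    qed
  qed simp
  then obtain s where s: "?A Mod N \<cong> free_Abelian_group {..<s::nat}" by blast
  have "infinite (UNIV :: 'l set)"
  proof
    assume "finite (UNIV :: 'l set)"
    then have "finite (range (\<lambda>k::int. v [^]\<^bsub>?A\<^esub> k))" by (rule finite_subset[OF subset_UNIV])
    moreover have "inj (\<lambda>k::int. v [^]\<^bsub>?A\<^esub> k)"
    proof
      fix k l :: int assume "v [^]\<^bsub>?A\<^esub> k = v [^]\<^bsub>?A\<^esub> l"
      then have "of_int k *\<^sub>R real_vec v = of_int l *\<^sub>R real_vec v" by (metis real_vec_int_pow)
      moreover have "real_vec v \<noteq> 0" using assms(1) by (metis real_vec_inject real_vec_zero)
      ultimately show "k = l" by simp
    qed
    ultimately have "finite (UNIV :: int set)" by (rule finite_imageD)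
    then show False by simp
  qed
  then have "infinite (UNIV :: 'l set set)" by (simp add: Finite_Set.finite_set)
  with s have "is_free_abelian (?A Mod N)" by (rule is_free_abelianI)
  then show ?thesis using assms(1) by (simp add: primitive_def N_def)
qed

text \<open>
  The class of \<open>v\<close> in the quotient by \<open>\<int>w\<close> is a torsion element.
\<close>

lemma primitive_imp_saturated:
  assumes "primitive w" "real_vec w = of_int k *\<^sub>R real_vec v"
  shows "\<exists>m::int. real_vec v = of_int m *\<^sub>R real_vec w"
proof -
  let ?A = "additive_group :: 'l monoid"
  interpret comm_group ?A by (rule comm_group_additive_group)
  define N where "N = generate ?A {w}"
  have car: "x \<in> carrier ?A" for x by (simp add: additive_group_def)
  have sub: "subgroup N ?A" unfolding N_def by (rule generate_is_subgroup) (simp add: additive_group_def)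
  interpret N: normal N ?A using sub by (rule subgroup_imp_normal)
  interpret q: group_hom ?A "?A Mod N" "\<lambda>x. N #>\<^bsub>?A\<^esub> x"
    using N.r_coset_hom_Mod N.factorgroup_is_group
    by (simp add: group_hom_def group_hom_axioms_def is_group)
  have "(N #>\<^bsub>?A\<^esub> v) [^]\<^bsub>?A Mod N\<^esub> k = N #>\<^bsub>?A\<^esub> (v [^]\<^bsub>?A\<^esub> k)"
    by (rule q.hom_int_pow[OF car, symmetric])
  also have "v [^]\<^bsub>?A\<^esub> k = w" using assms(2) by (metis int_pow_additive_group_eq_iff)
  also have "N #>\<^bsub>?A\<^esub> w = N"
    by (rule coset_join2[OF car sub]) (simp add: N_def generate.incl)
  finally have "(N #>\<^bsub>?A\<^esub> v) [^]\<^bsub>?A Mod N\<^esub> k = \<one>\<^bsub>?A Mod N\<^esub>" by (simp add: FactGroup_def)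
  moreover have "is_free_abelian (?A Mod N)" using assms(1) by (simp add: primitive_def N_def)
  moreover have "k \<noteq> 0"
    using assms by (metis of_int_0 primitive_def real_vec_inject real_vec_zero scaleR_zero_left)
  ultimately have "N #>\<^bsub>?A\<^esub> v = \<one>\<^bsub>?A Mod N\<^esub>"
    using is_free_abelian_imp_torsion_free[of "?A Mod N"] q.hom_closed[OF car] N.factorgroup_is_group
    by blast
  then have "N #>\<^bsub>?A\<^esub> v = N" by (simp add: FactGroup_def)
  then have "v \<in> N" using rcos_self[OF car sub] by auto
  then show ?thesis by (auto simp: N_def generate_additive_group)
qed

end

section \<open>Groups of isometries preserving the positive cone\<close>

context hyperbolic_lattice
begin

abbreviation isometry_group :: "('l \<Rightarrow> 'l) monoid" where
  "isometry_group \<equiv> positive_isometry_group \<phi> b P"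

lemma isometriesD:
  assumes "g \<in> isometries b"
  shows "bij g" "Modules.additive g" "b (g x) (g y) = b x y"
  using assms by (auto simp: isometries_def)

lemma comp_in_isometries: "g \<in> isometries b \<Longrightarrow> h \<in> isometries b \<Longrightarrow> g \<circ> h \<in> isometries b"
  by (auto simp: isometries_def Modules.additive_def bij_comp)

lemma inverse_in_isometries:
  assumes g: "g \<in> isometries b"
  shows "inv_into UNIV g \<in> isometries b"
proof -
  note gD = isometriesD[OF g]
  have gi: "g (inv_into UNIV g x) = x" for x using gD(1) by (simp add: bij_def surj_f_inv_f)
  have eqI: "x = y" if "g x = g y" for x y using gD(1) that by (simp add: bij_def inj_eq)
  have "inv_into UNIV g (x + y) = inv_into UNIV g x + inv_into UNIV g y" for x y
    by (rule eqI) (simp add: gi Modules.additive.add[OF gD(2)])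
  moreover have "b (inv_into UNIV g x) (inv_into UNIV g y) = b x y" for x y
    using gD(3)[of "inv_into UNIV g x" "inv_into UNIV g y"] by (simp add: gi)
  ultimately show ?thesis using gD(1) by (simp add: isometries_def Modules.additive_def bij_imp_bij_inv)
qed

lemma in_isometry_group_iff:
  "g \<in> carrier isometry_group \<longleftrightarrow> g \<in> isometries b \<and> (\<lambda>x. real_mat g *v x) ` P = P"
proof -
  have "(map_ext \<phi> g :: real ^ 'n \<Rightarrow> _) = (\<lambda>x. real_mat g *v x)" by (simp add: map_ext_def fun_eq_iff)
  then show ?thesis by (simp add: positive_isometry_group_def)
qed

lemma group_isometry_group: "group isometry_group"
proof (rule groupI)
  have id: "id \<in> carrier isometry_group"
    by (simp add: in_isometry_group_iff isometries_def Modules.additive_def real_mat_id)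
  then show "\<one>\<^bsub>isometry_group\<^esub> \<in> carrier isometry_group" by (simp add: positive_isometry_group_def)
  show "g \<otimes>\<^bsub>isometry_group\<^esub> h \<in> carrier isometry_group"
    if g: "g \<in> carrier isometry_group" and h: "h \<in> carrier isometry_group" for g h
  proof -
    have "real_mat (g \<circ> h) *v x = real_mat g *v (real_mat h *v x)" for x
      using g h by (simp add: in_isometry_group_iff real_mat_comp isometriesD matrix_vector_mul_assoc)
    then have "(\<lambda>x. real_mat (g \<circ> h) *v x) ` P = (\<lambda>x. real_mat g *v x) ` (\<lambda>x. real_mat h *v x) ` P"
      unfolding image_image by (rule image_cong[OF refl])
    also have "\<dots> = P" using g h by (simp add: in_isometry_group_iff)
    finally have "(\<lambda>x. real_mat (g \<circ> h) *v x) ` P = P" .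
    then show ?thesis
      using g h comp_in_isometries by (simp add: in_isometry_group_iff)
        (simp add: positive_isometry_group_def)
  qed
  show "\<exists>h\<in>carrier isometry_group. h \<otimes>\<^bsub>isometry_group\<^esub> g = \<one>\<^bsub>isometry_group\<^esub>"
    if g: "g \<in> carrier isometry_group" for g
  proof
    let ?h = "inv_into UNIV g"
    have giso: "g \<in> isometries b" and gP: "(\<lambda>x. real_mat g *v x) ` P = P"
      using g by (auto simp: in_isometry_group_iff)
    have hg: "?h \<circ> g = id" using isometriesD(1)[OF giso] by (simp add: bij_def)
    then have "real_mat ?h ** real_mat g = mat 1"
      using giso inverse_in_isometries by (metis isometriesD(2) real_mat_comp real_mat_id)
    then have "(\<lambda>x. real_mat ?h *v x) ` (\<lambda>x. real_mat g *v x) ` P = P"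
      by (simp add: image_image matrix_vector_mul_assoc)
    then show "?h \<in> carrier isometry_group"
      using giso gP inverse_in_isometries by (simp add: in_isometry_group_iff)
    show "?h \<otimes>\<^bsub>isometry_group\<^esub> g = \<one>\<^bsub>isometry_group\<^esub>"
      using hg by (simp add: positive_isometry_group_def)
  qed
qed (simp_all add: positive_isometry_group_def comp_assoc)

lemma real_of_trace_complex: "trace (matrix_ext \<phi> g :: complex ^ 'n ^ 'n) = of_real (trace (real_mat g))"
  by (simp add: trace_def matrix_ext_def)

lemma complex_eigenvalue_of_real:
  assumes "real_mat g *v x = t *\<^sub>R x" "x \<noteq> 0"
  shows "complex_of_real t \<in> eigenvalues (matrix_ext \<phi> g)"
proof -
  define z :: "complex ^ 'n" where "z = (\<chi> i. of_real (x $ i))"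
  have "(matrix_ext \<phi> g *v z) $ i = (complex_of_real t *s z) $ i" for i
  proof -
    have "(matrix_ext \<phi> g *v z) $ i = of_real ((real_mat g *v x) $ i)"
      by (simp add: matrix_vector_mult_def matrix_ext_def z_def)
    then show ?thesis by (simp add: assms(1) z_def)
  qed
  then have "matrix_ext \<phi> g *v z = complex_of_real t *s z" by (simp add: vec_eq_iff)
  moreover have "z \<noteq> 0" using assms(2) by (simp add: z_def vec_eq_iff)
  ultimately show ?thesis by (auto simp: eigenvalues_def eigenspace_def)
qed

end

locale isometry_subgroup = hyperbolic_lattice \<phi> b P
  for \<phi> :: "'l::ab_group_add \<Rightarrow> int ^ 'n::finite" and b P +
  fixes G :: "('l \<Rightarrow> 'l) set"
  assumes subgroup_G: "subgroup G (positive_isometry_group \<phi> b P)"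
begin

abbreviation "group_G \<equiv> isometry_group\<lparr>carrier := G\<rparr>"

lemma G_in_carrier: "g \<in> G \<Longrightarrow> g \<in> carrier isometry_group"
  using subgroup.subset[OF subgroup_G] by blast

lemma G_isometry: "g \<in> G \<Longrightarrow> g \<in> isometries b"
  and G_cone: "g \<in> G \<Longrightarrow> (\<lambda>x. real_mat g *v x) ` P = P"
  using G_in_carrier[of g] unfolding in_isometry_group_iff by blast+

lemma G_additive: "g \<in> G \<Longrightarrow> Modules.additive g"
  using G_isometry isometriesD by blast

lemma G_id: "id \<in> G"
  using subgroup.one_closed[OF subgroup_G] by (simp add: positive_isometry_group_def)

lemma G_comp: "g \<in> G \<Longrightarrow> h \<in> G \<Longrightarrow> g \<circ> h \<in> G"
  using subgroup.m_closed[OF subgroup_G, of g h] by (simp add: positive_isometry_group_def)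

lemma G_form: "g \<in> G \<Longrightarrow> b (g x) (g y) = b x y"
  using G_isometry isometriesD(3) by blast

lemma G_real_vec: "g \<in> G \<Longrightarrow> real_vec (g x) = real_mat g *v real_vec x"
  by (simp add: real_mat_real_vec G_additive)

lemma group_group_G: "group group_G"
  by (rule group.subgroup_imp_group[OF group_isometry_group subgroup_G])

lemma G_mult: "g \<otimes>\<^bsub>group_G\<^esub> h = g \<circ> h"
  by (simp add: positive_isometry_group_def)

lemma G_one: "\<one>\<^bsub>group_G\<^esub> = id"
  by (simp add: positive_isometry_group_def)

lemma G_inv:
  assumes "g \<in> G"
  shows "inv\<^bsub>group_G\<^esub> g \<in> G" "(inv\<^bsub>group_G\<^esub> g) (g x) = x" "g ((inv\<^bsub>group_G\<^esub> g) x) = x"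
proof -
  interpret group group_G by (rule group_group_G)
  have g: "g \<in> carrier group_G" using assms by simp
  show "inv\<^bsub>group_G\<^esub> g \<in> G" using inv_closed[OF g] by simp
  show "(inv\<^bsub>group_G\<^esub> g) (g x) = x" "g ((inv\<^bsub>group_G\<^esub> g) x) = x"
    using l_inv[OF g] r_inv[OF g] unfolding G_mult G_one by (auto simp: fun_eq_iff)
qed

end

section \<open>The stabilizer of an isotropic lattice vector\<close>

text \<open>
  Saturation says that \<open>v\<close> generates the group of lattice points on its real line.
\<close>

locale fixed_isotropic_vector = isometry_subgroup \<phi> b P G
  for \<phi> :: "'l::ab_group_add \<Rightarrow> int ^ 'n::finite" and b P G +
  fixes v :: 'l
  assumes v_nonzero: "v \<noteq> 0" and v_isotropic: "b v v = 0"
    and saturated: "real_vec x = t *\<^sub>R real_vec v \<Longrightarrow> \<exists>k::int. real_vec x = of_int k *\<^sub>R real_vec v"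
    and G_fixes: "g \<in> G \<Longrightarrow> g v = v"
begin

text \<open>
  The elements that act trivially on \<open>v\<^sup>\<bottom> / \<int>v\<close>; for a fixed isotropic \<open>v\<close> these are the Eichler
  transvections in \<open>G\<close>.
\<close>

definition transvections :: "('l \<Rightarrow> 'l) set" where
  "transvections =
    {g \<in> G. \<forall>x. b v x = 0 \<longrightarrow> (\<exists>k::int. real_vec (g x - x) = of_int k *\<^sub>R real_vec v)}"

lemma real_vec_v_nonzero: "real_vec v \<noteq> 0"
  using v_nonzero by (metis real_vec_inject real_vec_zero)

lemma ip_v_isotropic: "ip (real_vec v) (real_vec v) = 0"
  by (simp add: ip_real_vec v_isotropic)

lemma multiple_if_isotropic_orthogonal:
  assumes "b v x = 0" "b x x = 0"
  shows "\<exists>k::int. real_vec x = of_int k *\<^sub>R real_vec v"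
proof -
  obtain t where "real_vec x = t *\<^sub>R real_vec v"
    using multiple_if_orthogonal_to_isotropic[OF real_vec_v_nonzero ip_v_isotropic, of "real_vec x"] assms
    by (auto simp: ip_real_vec)
  then show ?thesis by (rule saturated)
qed

lemma G_orthogonal: "g \<in> G \<Longrightarrow> b v (g x) = b v x"
  using G_form[of g v x] by (simp add: G_fixes)

lemma G_real_multiple: "g \<in> G \<Longrightarrow> real_vec x = t *\<^sub>R real_vec v \<Longrightarrow> real_vec (g x) = t *\<^sub>R real_vec v"
  by (simp add: G_real_vec matrix_vector_mult_scaleR) (metis G_fixes G_real_vec)

text \<open>
  For \<open>w = g y - y\<close> one has \<open>(w, x) = 0\<close> for all \<open>x \<in> v\<^sup>\<bottom>\<close>, so \<open>w\<close> is orthogonal to \<open>v\<close> and to itself,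
  hence \<open>w = k v\<close>. Since \<open>g y\<close> and \<open>y\<close> have the same norm, \<open>k (y, v) = 0\<close>.
\<close>

lemma identity_if_identity_on_orthogonal:
  assumes g: "g \<in> G" and fixed: "\<And>x. b v x = 0 \<Longrightarrow> g x = x"
  shows "g = id"
proof
  fix y
  define w where "w = g y - y"
  have "b x w = 0" if "b v x = 0" for x
    using G_form[OF g, of x y] fixed[OF that] by (simp add: w_def form.diff)
  then have "b v w = 0" and "b w w = 0" using v_isotropic by auto
  then obtain k :: int where k: "real_vec w = of_int k *\<^sub>R real_vec v"
    using multiple_if_isotropic_orthogonal by blast
  have "b (y + w) (y + w) = b y y" using G_form[OF g, of y y] by (simp add: w_def)
  then have "b y w = 0"
    using \<open>b w w = 0\<close> by (simp add: form.add form_commute[of "y + w"] form_commute[of w y])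
  then have "k * b v y = 0"
    using ip_real_vec[of y w] ip_real_vec[of y v] form_commute[of v y] by (simp add: k ip_simps)
  then show "g y = id y"
  proof (cases "k = 0")
    case True
    then have "w = 0" using k by (metis of_int_0 real_vec_inject real_vec_zero scaleR_zero_left)
    then show ?thesis by (simp add: w_def)
  next
    case False
    then show ?thesis using \<open>k * b v y = 0\<close> fixed by simp
  qed
qed

text \<open>
  The hyperplane \<open>v\<^sup>\<bottom>\<close> has dimension \<open>r - 1\<close>. A maximal independent set of its lattice vectors that
  contains \<open>v\<close> leaves at most \<open>r - 2\<close> vectors besides \<open>v\<close>; this is the source of the bound on the rank.
\<close>

lemma obtain_orthogonal_basis:
  obtains B where "finite B" "v \<in> B" "\<And>x. x \<in> B \<Longrightarrow> b v x = 0" "card (B - {v}) + 2 \<le> CARD('n)"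
    "\<And>x. b v x = 0 \<Longrightarrow> real_vec x \<in> span (real_vec ` B)"
proof -
  define V where "V = real_vec ` {x. b v x = 0}"
  have "{real_vec v} \<subseteq> V" using v_isotropic by (auto simp: V_def)
  moreover have "independent {real_vec v}" using real_vec_v_nonzero by (simp add: dependent_single)
  ultimately obtain C where C: "{real_vec v} \<subseteq> C" "C \<subseteq> V" "independent C" "V \<subseteq> span C"
    by (rule maximal_independent_subset_extend)
  define B where "B = {x. real_vec x \<in> C}"
  have img: "real_vec ` B = C" using C(2) by (auto simp: B_def V_def)
  have inj: "inj_on real_vec B" by (rule inj_onI) (simp add: real_vec_inject)
  have "finite C" using C(3) by (rule independent_imp_finite)
  then have finB: "finite B" using img inj finite_imageD by metis
  have vB: "v \<in> B" using C(1) by (simp add: B_def)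
  have "V \<subseteq> {x. (gram *v real_vec v) \<bullet> x = 0}"
  proof
    fix y assume "y \<in> V"
    then obtain x where "y = real_vec x" "b v x = 0" by (auto simp: V_def)
    then have "ip y (real_vec v) = 0" by (simp add: ip_real_vec form_commute)
    then show "y \<in> {x. (gram *v real_vec v) \<bullet> x = 0}" by (simp add: ip_def inner_commute)
  qed
  then have "card C \<le> dim {x. (gram *v real_vec v) \<bullet> x = 0}"
    using C by (intro independent_card_le_dim) auto
  moreover have "gram *v real_vec v \<noteq> 0" using nondegenerate real_vec_v_nonzero by blast
  ultimately have "card C \<le> CARD('n) - 1" by (simp add: dim_hyperplane)
  moreover have "card C = card B" using img inj card_image by metis
  moreover have "card B > 0" using finB vB by (auto simp: card_gt_0_iff)
  ultimately have "card (B - {v}) + 2 \<le> CARD('n)" using vB finB by simp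
  moreover have "b v x = 0" if "x \<in> B" for x
  proof -
    have "real_vec x \<in> V" using that C(2) by (auto simp: B_def)
    then show ?thesis by (auto simp: V_def real_vec_inject)
  qed
  moreover have "real_vec x \<in> span (real_vec ` B)" if "b v x = 0" for x
    using that C(4) unfolding img V_def by blast
  ultimately show thesis using that finB vB by blast
qed

lemma transvections_D:
  assumes "g \<in> transvections"
  shows "g \<in> G" "b v x = 0 \<Longrightarrow> \<exists>k::int. real_vec (g x - x) = of_int k *\<^sub>R real_vec v"
  using assms by (auto simp: transvections_def)

lemma transvections_comp:
  assumes g: "g \<in> G" and h: "h \<in> G"
    and gx: "real_vec (g x - x) = s *\<^sub>R real_vec v" and hx: "real_vec (h x - x) = t *\<^sub>R real_vec v"
  shows "real_vec ((g \<circ> h) x - x) = (s + t) *\<^sub>R real_vec v"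
proof -
  interpret g: Modules.additive g using g by (rule G_additive)
  have "(g \<circ> h) x - x = g (h x - x) + (g x - x)" by (simp add: g.diff)
  then show ?thesis
    using G_real_multiple[OF g hx] gx by (simp only: real_vec_add scaleR_add_left) simp
qed

lemma normal_transvections: "transvections \<lhd> group_G"
proof -
  interpret group group_G by (rule group_group_G)
  have sub: "subgroup transvections group_G"
  proof (rule subgroupI)
    show "transvections \<subseteq> carrier group_G" by (auto simp: transvections_def)
    have "id \<in> G" using one_closed unfolding G_one by simp
    then have "id \<in> transvections" by (auto simp: transvections_def real_vec_zero intro: exI[of _ 0])
    then show "transvections \<noteq> {}" by blast
    show "g \<otimes>\<^bsub>group_G\<^esub> h \<in> transvections" if g: "g \<in> transvections" and h: "h \<in> transvections" for g h
    proof -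
      have "\<exists>k::int. real_vec ((g \<circ> h) x - x) = of_int k *\<^sub>R real_vec v" if x: "b v x = 0" for x
      proof -
        obtain k l :: int where "real_vec (g x - x) = of_int k *\<^sub>R real_vec v"
          "real_vec (h x - x) = of_int l *\<^sub>R real_vec v"
          using transvections_D(2)[OF g x] transvections_D(2)[OF h x] by blast
        from transvections_comp[OF transvections_D(1)[OF g] transvections_D(1)[OF h] this] show ?thesis
          by (intro exI[of _ "k + l"]) simp
      qed
      moreover have "g \<circ> h \<in> G"
        using m_closed[of g h] transvections_D(1)[OF g] transvections_D(1)[OF h] unfolding G_mult by simp
      ultimately show ?thesis unfolding G_mult transvections_def by blast
    qed
    show "inv\<^bsub>group_G\<^esub> g \<in> transvections" if g: "g \<in> transvections" for g
    proof -
      let ?h = "inv\<^bsub>group_G\<^esub> g"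
      have gG: "g \<in> G" using g by (rule transvections_D(1))
      interpret h: Modules.additive ?h using G_inv(1)[OF gG] by (rule G_additive)
      have "\<exists>k::int. real_vec (?h x - x) = of_int k *\<^sub>R real_vec v" if x: "b v x = 0" for x
      proof -
        obtain k :: int where k: "real_vec (g x - x) = of_int k *\<^sub>R real_vec v"
          using transvections_D(2)[OF g x] by blast
        have "?h x - x = - ?h (g x - x)" by (simp add: h.diff G_inv(2)[OF gG])
        then have "real_vec (?h x - x) = - of_int k *\<^sub>R real_vec v"
          using G_real_multiple[OF G_inv(1)[OF gG] k] by (simp add: real_vec_minus)
        then show ?thesis by (intro exI[of _ "- k"]) simp
      qed
      then show ?thesis using G_inv(1)[OF gG] by (simp add: transvections_def)
    qed
  qed
  have "g \<otimes>\<^bsub>group_G\<^esub> h \<otimes>\<^bsub>group_G\<^esub> inv\<^bsub>group_G\<^esub> g \<in> transvections" if gc: "g \<in> carrier group_G" and h: "h \<in> transvections" for g h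
  proof -
    let ?i = "inv\<^bsub>group_G\<^esub> g"
    have g: "g \<in> G" using gc by simp
    interpret g: Modules.additive g using g by (rule G_additive)
    have "\<exists>k::int. real_vec ((g \<circ> h \<circ> ?i) x - x) = of_int k *\<^sub>R real_vec v" if x: "b v x = 0" for x
    proof -
      have "b v (?i x) = 0" using x G_orthogonal[OF G_inv(1)[OF g]] by simp
      then obtain k :: int where k: "real_vec (h (?i x) - ?i x) = of_int k *\<^sub>R real_vec v"
        using transvections_D(2)[OF h] by blast
      have "(g \<circ> h \<circ> ?i) x - x = g (h (?i x) - ?i x)" by (simp add: g.diff G_inv(3)[OF g])
      then show ?thesis using G_real_multiple[OF g k] by auto
    qed
    moreover have "g \<circ> h \<circ> ?i \<in> G"
      using m_closed[OF m_closed[OF gc, of h] inv_closed[OF gc]] transvections_D(1)[OF h] unfolding G_mult by simp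
    ultimately show ?thesis unfolding G_mult transvections_def by blast
  qed
  with sub show ?thesis by (simp add: normal_inv_iff)
qed

text \<open>
  By the Cauchy-Schwarz inequality the integers \<open>(g x, y)\<close>, for \<open>x\<close> and \<open>y\<close> in a finite set spanning
  \<open>v\<^sup>\<bottom>\<close>, are bounded independently of \<open>g\<close>. If \<open>g\<close> and \<open>h\<close> have the same table of values, then
  \<open>g x - h x\<close> is orthogonal to \<open>v\<^sup>\<bottom>\<close> and lies in it, so it is a multiple of \<open>v\<close>.
\<close>

lemma finite_index_transvections: "finite (rcosets\<^bsub>group_G\<^esub> transvections)"
proof -
  interpret group group_G by (rule group_group_G)
  obtain B where B: "finite B" "v \<in> B" "\<And>x. x \<in> B \<Longrightarrow> b v x = 0"
    "\<And>x. b v x = 0 \<Longrightarrow> real_vec x \<in> span (real_vec ` B)"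
    using obtain_orthogonal_basis by metis
  define F where "F g = restrict (\<lambda>(x, y). b (g x) y) (B \<times> B)" for g :: "'l \<Rightarrow> 'l"
  show ?thesis
  proof (rule finite_rcosets_if_separated[where F = F])
    show "group group_G" by (rule group_group_G)
    show "subgroup transvections group_G" using normal_transvections by (rule normal_imp_subgroup)
    have bound: "\<bar>b (g x) y\<bar> \<le> \<bar>b x x * b y y\<bar>" if g: "g \<in> G" and xy: "x \<in> B" "y \<in> B" for g x y
    proof -
      have "ip (real_vec v) (real_vec (g x)) = 0" "ip (real_vec v) (real_vec y) = 0"
        using B(3) xy G_orthogonal[OF g] by (simp_all add: ip_real_vec)
      then have "(ip (real_vec (g x)) (real_vec y))\<^sup>2
          \<le> ip (real_vec (g x)) (real_vec (g x)) * ip (real_vec y) (real_vec y)"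
        by (rule cauchy_schwarz_orthogonal_to_isotropic[OF real_vec_v_nonzero ip_v_isotropic])
      then have "real_of_int ((b (g x) y)\<^sup>2) \<le> real_of_int (b x x * b y y)"
        by (simp add: ip_real_vec G_form[OF g])
      then have "(b (g x) y)\<^sup>2 \<le> b x x * b y y" by (simp only: of_int_le_iff)
      moreover have "\<bar>n\<bar> \<le> n\<^sup>2" for n :: int
        using mult_left_mono[of 1 "\<bar>n\<bar>" "\<bar>n\<bar>"] by (cases "n = 0") (auto simp: power2_eq_square)
      then have "\<bar>b (g x) y\<bar> \<le> (b (g x) y)\<^sup>2" .
      ultimately show ?thesis by linarith
    qed
    have "F ` carrier group_G \<subseteq> (\<Pi>\<^sub>E p\<in>B \<times> B. {- \<bar>b (fst p) (fst p) * b (snd p) (snd p)\<bar> ..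
        \<bar>b (fst p) (fst p) * b (snd p) (snd p)\<bar>})"
    proof
      fix f assume "f \<in> F ` carrier group_G"
      then obtain g where g: "g \<in> G" "f = F g" by auto
      show "f \<in> (\<Pi>\<^sub>E p\<in>B \<times> B. {- \<bar>b (fst p) (fst p) * b (snd p) (snd p)\<bar> ..
          \<bar>b (fst p) (fst p) * b (snd p) (snd p)\<bar>})"
      proof (rule PiE_I)
        fix p assume p: "p \<in> B \<times> B"
        then have "\<bar>f p\<bar> \<le> \<bar>b (fst p) (fst p) * b (snd p) (snd p)\<bar>"
          using bound[OF g(1), of "fst p" "snd p"] by (simp add: g(2) F_def case_prod_beta mem_Times_iff)
        then show "f p \<in> {- \<bar>b (fst p) (fst p) * b (snd p) (snd p)\<bar> ..
            \<bar>b (fst p) (fst p) * b (snd p) (snd p)\<bar>}"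
          by (simp add: abs_le_iff minus_le_iff)
      next
        fix p assume "p \<notin> B \<times> B"
        then show "f p = undefined" unfolding g(2) F_def by (rule restrict_apply[THEN trans, OF if_not_P])
      qed
    qed
    moreover have "finite (\<Pi>\<^sub>E p\<in>B \<times> B. {- \<bar>b (fst p) (fst p) * b (snd p) (snd p)\<bar> ..
        \<bar>b (fst p) (fst p) * b (snd p) (snd p)\<bar>})"
      using B(1) by (intro finite_PiE) auto
    ultimately show "finite (F ` carrier group_G)" by (rule finite_subset)
  next
    fix g h assume "g \<in> carrier group_G" "h \<in> carrier group_G" and eq: "F g = F h"
    then have g: "g \<in> G" and h: "h \<in> G" by simp_all
    have Bdiff: "real_mat g *v z - real_mat h *v z \<in> span {real_vec v}" if z: "z \<in> real_vec ` B" for z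
    proof -
      obtain x where x: "x \<in> B" "z = real_vec x" using z by blast
      define w where "w = g x - h x"
      have "b w y = 0" if "y \<in> B" for y
        using fun_cong[OF eq, of "(x, y)"] x(1) that
        by (simp add: F_def w_def form_commute[of _ y] form.diff)
      then have "real_vec ` B \<subseteq> {y. ip (real_vec w) y = 0}" by (auto simp: ip_real_vec)
      moreover have "subspace {y. ip (real_vec w) y = 0}"
        by (auto simp: subspace_def ip_simps ip.zero_right)
      ultimately have "span (real_vec ` B) \<subseteq> {y. ip (real_vec w) y = 0}" by (rule span_minimal)
      moreover have vw: "b v w = 0"
        using G_orthogonal[OF g, of x] G_orthogonal[OF h, of x] by (simp add: w_def form.diff)
      ultimately have "ip (real_vec w) (real_vec w) = 0" using B(4)[OF vw] by blast
      then have "b w w = 0" by (simp add: ip_real_vec)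
      then obtain k :: int where k: "real_vec w = of_int k *\<^sub>R real_vec v"
        using multiple_if_isotropic_orthogonal vw by blast
      have "real_mat g *v z - real_mat h *v z = real_vec w"
        by (simp add: x(2) w_def real_vec_diff G_real_vec g h)
      then show ?thesis using k by (metis insertI1 span_base span_mul)
    qed
    have "subspace {z. real_mat g *v z - real_mat h *v z \<in> span {real_vec v}}"
    proof -
      have "{z. real_mat g *v z - real_mat h *v z \<in> span {real_vec v}}
          = (\<lambda>z. (real_mat g - real_mat h) *v z) -` span {real_vec v}"
        by (auto simp: matrix_vector_mult_diff_rdistrib)
      then show ?thesis
        using linear_subspace_vimage[OF matrix_vector_mul_linear subspace_span] by metis
    qed
    then have spanB: "span (real_vec ` B) \<subseteq> {z. real_mat g *v z - real_mat h *v z \<in> span {real_vec v}}"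
      using Bdiff by (intro span_minimal) auto
    let ?i = "inv\<^bsub>group_G\<^esub> h"
    have "\<exists>k::int. real_vec ((g \<circ> ?i) x - x) = of_int k *\<^sub>R real_vec v" if x: "b v x = 0" for x
    proof -
      have "b v (?i x) = 0" using x G_orthogonal[OF G_inv(1)[OF h]] by simp
      then have "real_mat g *v real_vec (?i x) - real_mat h *v real_vec (?i x) \<in> span {real_vec v}"
        using spanB B(4) by blast
      moreover have "real_vec ((g \<circ> ?i) x - x) = real_mat g *v real_vec (?i x) - real_mat h *v real_vec (?i x)"
        by (simp add: real_vec_diff G_inv(3)[OF h] g h flip: G_real_vec)
      ultimately obtain t where "real_vec ((g \<circ> ?i) x - x) = t *\<^sub>R real_vec v"
        by (auto simp: span_singleton)
      then show ?thesis by (rule saturated)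
    qed
    moreover have "g \<circ> ?i \<in> G"
      using m_closed[of g ?i] inv_closed[of h] g h unfolding G_mult by simp
    ultimately show "g \<otimes>\<^bsub>group_G\<^esub> ?i \<in> transvections" unfolding G_mult transvections_def by blast
  qed
qed

text \<open>
  For \<open>x\<close> in the chosen set, \<open>g x = x + shift x g v\<close> defines a homomorphism \<open>shift x\<close>, because \<open>g\<close>
  fixes \<open>v\<close>. If all of them vanish at \<open>g\<close>, then \<open>g\<close> is the identity on \<open>v\<^sup>\<bottom>\<close>.
\<close>

lemma free_abelian_transvections: "\<exists>s. s + 2 \<le> CARD('n) \<and> isometry_group\<lparr>carrier := transvections\<rparr> \<cong> free_Abelian_group {..<s}"
proof -
  obtain B where B: "finite B" "v \<in> B" "\<And>x. x \<in> B \<Longrightarrow> b v x = 0" "card (B - {v}) + 2 \<le> CARD('n)"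
    "\<And>x. b v x = 0 \<Longrightarrow> real_vec x \<in> span (real_vec ` B)"
    using obtain_orthogonal_basis by metis
  define shift where "shift x g = (THE k::int. real_vec (g x - x) = of_int k *\<^sub>R real_vec v)" for x g
  have shift: "real_vec (g x - x) = of_int k *\<^sub>R real_vec v \<longleftrightarrow> shift x g = k"
    if g: "g \<in> transvections" and x: "b v x = 0" for g x k
  proof -
    obtain l :: int where l: "real_vec (g x - x) = of_int l *\<^sub>R real_vec v" using transvections_D(2)[OF g x] by blast
    then have uniq: "real_vec (g x - x) = of_int k *\<^sub>R real_vec v \<longleftrightarrow> k = l" for k :: int
      using real_vec_v_nonzero by auto
    then have "shift x g = l" unfolding shift_def by (intro the_equality) auto
    then show ?thesis using uniq by auto
  qed
  have "\<exists>s\<le>card (B - {v}). isometry_group\<lparr>carrier := transvections\<rparr> \<cong> free_Abelian_group {..<s}"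
  proof (rule iso_free_Abelian_group_if_jointly_injective_homs_to_integers[where h = shift])
    show "finite (B - {v})" using B(1) by simp
    have sub: "subgroup transvections group_G" using normal_transvections by (rule normal_imp_subgroup)
    show "group (isometry_group\<lparr>carrier := transvections\<rparr>)"
      using group.subgroup_imp_group[OF group_group_G sub] by simp
    show "shift x \<in> hom (isometry_group\<lparr>carrier := transvections\<rparr>) integer_group" if x: "x \<in> B - {v}" for x
    proof (rule homI)
      fix g h assume "g \<in> carrier (isometry_group\<lparr>carrier := transvections\<rparr>)" "h \<in> carrier (isometry_group\<lparr>carrier := transvections\<rparr>)"
      then have g: "g \<in> transvections" and h: "h \<in> transvections" by simp_all
      have vx: "b v x = 0" using x B(3) by blast
      have "g \<circ> h \<in> transvections" using subgroup.m_closed[OF sub g h] unfolding G_mult .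
      moreover have "real_vec ((g \<circ> h) x - x) = (of_int (shift x g) + of_int (shift x h)) *\<^sub>R real_vec v"
        using shift[OF g vx] shift[OF h vx] by (intro transvections_comp transvections_D(1)[OF g] transvections_D(1)[OF h]) auto
      ultimately have "shift x (g \<circ> h) = shift x g + shift x h"
        using shift[of "g \<circ> h" x, OF _ vx] by (metis of_int_add)
      then show "shift x (g \<otimes>\<^bsub>isometry_group\<lparr>carrier := transvections\<rparr>\<^esub> h) = shift x g \<otimes>\<^bsub>integer_group\<^esub> shift x h"
        by (simp add: positive_isometry_group_def)
    qed simp
    fix g assume "g \<in> carrier (isometry_group\<lparr>carrier := transvections\<rparr>)"
      and zero: "\<And>x. x \<in> B - {v} \<Longrightarrow> shift x g = 0"
    then have g0: "g \<in> transvections" by simp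
    then have g: "g \<in> G" by (rule transvections_D(1))
    have "g x = x" if x: "x \<in> B" for x
    proof (cases "x = v")
      case True
      then show ?thesis using G_fixes[OF g] by simp
    next
      case False
      then have "real_vec (g x - x) = of_int 0 *\<^sub>R real_vec v"
        using shift[OF g0 B(3)[OF x]] zero x by blast
      then have "real_vec (g x) = real_vec x" by (simp add: real_vec_diff)
      then show ?thesis by (simp add: real_vec_inject)
    qed
    then have "real_vec ` B \<subseteq> {z. real_mat g *v z = z}" by (auto simp flip: G_real_vec[OF g])
    moreover have "subspace {z. real_mat g *v z = z}"
      by (auto simp: subspace_def matrix_vector_right_distrib matrix_vector_mult_scaleR)
    ultimately have "span (real_vec ` B) \<subseteq> {z. real_mat g *v z = z}" by (rule span_minimal)
    then have "real_vec (g x) = real_vec x" if "b v x = 0" for x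
      using B(5)[OF that] by (auto simp: G_real_vec[OF g])
    then have "g x = x" if "b v x = 0" for x using that by (simp add: real_vec_inject)
    then have "g = id" using g by (rule identity_if_identity_on_orthogonal[rotated])
    then show "g = \<one>\<^bsub>isometry_group\<lparr>carrier := transvections\<rparr>\<^esub>" by (simp add: positive_isometry_group_def)
  qed
  then obtain s where "s \<le> card (B - {v})" "isometry_group\<lparr>carrier := transvections\<rparr> \<cong> free_Abelian_group {..<s}"
    by blast
  then show ?thesis using B(4) by (intro exI[of _ s] conjI) linarith+
qed

end

section \<open>Groups of null entropy\<close>

text \<open>
  A \<open>\<rat>\<close>-linear functional on \<open>\<real>\<close>, obtained by extending \<open>{x}\<close> to a Hamel basis. Its values are
  regarded as real numbers.
\<close>

lemma rational_functional_nonzero_at: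
  fixes x :: real
  assumes "x \<noteq> 0"
  obtains f :: "real \<Rightarrow> real" where "Modules.additive f" "\<And>y. f y \<in> \<rat>" "f x = 1"
    "\<And>q y. q \<in> \<rat> \<Longrightarrow> f (q * y) = q * f y"
proof -
  interpret vector_space_pair "\<lambda>(q::rat) (y::real). of_rat q * y" "(*) :: rat \<Rightarrow> rat \<Rightarrow> rat"
    by unfold_locales (auto simp: algebra_simps of_rat_add of_rat_mult)
  have "vs1.independent {x}"
    using assms by (simp add: vs1.dependent_single)
  from linear_independent_extend[OF this, of "\<lambda>_. 1"]
  obtain g where g: "Vector_Spaces.linear (\<lambda>(q::rat) (y::real). of_rat q * y) (*) g" "g x = 1"
    by auto
  interpret g: Vector_Spaces.linear "\<lambda>(q::rat) (y::real). of_rat q * y" "(*)" g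
    by fact
  show thesis
  proof
    show "Modules.additive (\<lambda>y. real_of_rat (g y))"
      by (simp add: Modules.additive_def g.add of_rat_add)
    show "real_of_rat (g x) = 1" using g by simp
    show "real_of_rat (g (q * y)) = q * real_of_rat (g y)" if "q \<in> \<rat>" for q y
      using that by (auto elim!: Rats_cases simp: g.scale of_rat_mult)
  qed simp
qed

lemma common_denominator:
  fixes x :: "real ^ 'n::finite"
  assumes "\<And>i. x $ i \<in> \<rat>"
  obtains d :: int and v :: "int ^ 'n" where "d > 0" "\<And>i. of_int (v $ i) = of_int d * x $ i"
proof -
  have "\<exists>d::int. d > 0 \<and> of_int d * x $ i \<in> \<int>" for i
  proof -
    obtain p q :: int where "q > 0" "x $ i = of_int p / of_int q"
      using assms[of i] by (auto elim!: Rats_cases')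
    then have "of_int q * x $ i = of_int p" by simp
    then show ?thesis using \<open>q > 0\<close> Ints_of_int by metis
  qed
  then obtain d where d: "\<And>i. d i > (0::int)" "\<And>i. of_int (d i) * x $ i \<in> \<int>" by metis
  have "of_int (\<Prod>i\<in>UNIV. d i) * x $ i \<in> \<int>" for i
  proof -
    have "(\<Prod>i\<in>UNIV. d i) = d i * (\<Prod>j\<in>UNIV - {i}. d j)" by (rule prod.remove) auto
    then have "of_int (\<Prod>i\<in>UNIV. d i) * x $ i = of_int (\<Prod>j\<in>UNIV - {i}. d j) * (of_int (d i) * x $ i)"
      by simp
    then show ?thesis using d(2)[of i] by (metis Ints_mult Ints_of_int)
  qed
  then have "\<exists>v. \<forall>i. of_int (\<Prod>i\<in>UNIV. d i) * x $ i = of_int (v i)"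
    by (intro choice) (auto elim!: Ints_cases)
  then obtain v where "\<And>i. of_int (\<Prod>i\<in>UNIV. d i) * x $ i = of_int (v i)" by blast
  then show thesis
    using that[of "\<Prod>i\<in>UNIV. d i" "\<chi> i. v i"] d(1) by (simp add: prod_pos)
qed

locale null_entropy_group = isometry_subgroup \<phi> b P G
  for \<phi> :: "'l::ab_group_add \<Rightarrow> int ^ 'n::finite" and b P G +
  assumes infinite_G: "infinite G"
    and null_entropy: "g \<in> G \<Longrightarrow> entropy \<phi> g = 0"
begin

lemma eigenvalue_le_1:
  assumes "g \<in> G" "real_mat g *v x = t *\<^sub>R x" "x \<noteq> 0"
  shows "\<bar>t\<bar> \<le> 1"
  using cmod_eigenvalue_le_1_if_entropy_0[OF null_entropy[OF assms(1)] complex_eigenvalue_of_real[OF assms(2,3)]]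
  by simp

text \<open>
  An eigenvalue \<open>t\<close> of \<open>g\<close> on the invariant isotropic line satisfies \<open>\<bar>t\<bar> \<le> 1\<close>, and so does its inverse.
  It is positive since \<open>g\<close> preserves the cone, on which \<open>(\<cdot>, c)\<close> has constant sign.
\<close>

lemma invariant_isotropic_vector:
  obtains c where "c \<noteq> 0" "ip c c = 0" "\<And>p. p \<in> P \<Longrightarrow> ip p c > 0"
    "\<And>g. g \<in> G \<Longrightarrow> real_mat g *v c = c"
    "\<And>x. (\<And>g. g \<in> G \<Longrightarrow> real_mat g *v x = x) \<Longrightarrow> ip c x = 0"
proof -
  have inj: "inj_on real_mat G"
    by (rule inj_onI) (metis G_additive real_mat_inject)
  have "\<exists>c. c \<noteq> 0 \<and> ip c c = 0 \<and> (\<forall>A\<in>real_mat ` G. \<exists>t. A *v c = t *\<^sub>R c)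
      \<and> (\<forall>x. (\<forall>A\<in>real_mat ` G. A *v x = x) \<longrightarrow> ip c x = 0)"
  proof (rule invariant_isotropic_line[where M = "real_mat ` G" and C = "real CARD('n)"])
    show "infinite (real_mat ` G)" using infinite_G inj finite_imageD by blast
    show "A $ i $ j \<in> \<int>" if "A \<in> real_mat ` G" for A i j
      using that by (auto simp: matrix_ext_def)
    show "A ** B \<in> real_mat ` G" if "A \<in> real_mat ` G" "B \<in> real_mat ` G" for A B
      using that by (auto simp: G_additive G_comp simp flip: real_mat_comp intro!: imageI)
    show "mat 1 \<in> real_mat ` G" using G_id real_mat_id by (metis imageI)
    show "ip (A *v x) (A *v y) = ip x y" if "A \<in> real_mat ` G" for A x y
      using that real_mat_isometry[OF G_isometry] by (auto simp: ip_def)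
    show "\<bar>trace A\<bar> \<le> real CARD('n)" if A: "A \<in> real_mat ` G" for A
    proof -
      obtain g where g: "g \<in> G" "A = real_mat g" using A by blast
      have "cmod (trace (matrix_ext \<phi> g :: complex ^ 'n ^ 'n)) \<le> real CARD('n)"
        by (rule norm_trace_le_if_eigenvalues_le_1)
          (rule cmod_eigenvalue_le_1_if_entropy_0[OF null_entropy[OF g(1)]])
      then show ?thesis by (simp add: g(2) real_of_trace_complex)
    qed
  qed blast
  then obtain c0 where c0: "c0 \<noteq> 0" "ip c0 c0 = 0" "\<And>g. g \<in> G \<Longrightarrow> \<exists>t. real_mat g *v c0 = t *\<^sub>R c0"
    "\<And>x. (\<And>g. g \<in> G \<Longrightarrow> real_mat g *v x = x) \<Longrightarrow> ip c0 x = 0"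
    by auto
  obtain p0 where p0: "p0 \<in> P" using cone_nonempty by auto
  define c where "c = sgn (ip p0 c0) *\<^sub>R c0"
  have nz: "ip p0 c0 \<noteq> 0" using ip_positive_isotropic_nonzero[OF cone_positive[OF p0] c0(1,2)] .
  have c: "c \<noteq> 0" "ip c c = 0" using c0 nz by (auto simp: c_def ip_simps sgn_zero_iff)
  have "ip p0 c > 0" using nz by (simp add: c_def ip_simps abs_sgn[symmetric] mult.commute)
  then have pos: "ip p c > 0" if "p \<in> P" for p
    using ip_cone_isotropic_sign[OF c p0] that by blast
  have fixed: "real_mat g *v c = c" if g: "g \<in> G" for g
  proof -
    obtain t where t0: "real_mat g *v c0 = t *\<^sub>R c0" using c0(3)[OF g] by blast
    then have t: "real_mat g *v c = t *\<^sub>R c" by (simp add: c_def matrix_vector_mult_scaleR)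
    obtain h where h: "h \<in> G" and hg: "\<And>x. h (g x) = x" using G_inv[OF g] by blast
    have hg: "h \<circ> g = id" by (simp add: fun_eq_iff hg)
    have "real_mat h *v (real_mat g *v c) = c"
      using h g by (simp add: matrix_vector_mul_assoc G_additive hg real_mat_id flip: real_mat_comp)
    then have th: "t *\<^sub>R (real_mat h *v c) = c" by (simp add: t matrix_vector_mult_scaleR)
    then have "t \<noteq> 0" using c(1) by auto
    have "real_mat h *v c = (1 / t) *\<^sub>R (t *\<^sub>R (real_mat h *v c))" using \<open>t \<noteq> 0\<close> by simp
    then have "real_mat h *v c = (1 / t) *\<^sub>R c" unfolding th .
    then have "\<bar>1 / t\<bar> \<le> 1" using eigenvalue_le_1[OF h] c(1) by blast
    moreover have "\<bar>t\<bar> \<le> 1" using eigenvalue_le_1[OF g t c(1)] .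
    ultimately have "\<bar>t\<bar> = 1" using \<open>t \<noteq> 0\<close> by (simp add: abs_divide divide_le_eq)
    moreover have "t > 0"
    proof -
      have "real_mat g *v p0 \<in> P" using G_cone[OF g] p0 by auto
      then have "ip (real_mat g *v p0) c > 0" by (rule pos)
      moreover have "t * ip (real_mat g *v p0) c = ip p0 c"
        using real_mat_isometry[OF G_isometry[OF g], of p0 c] by (simp add: t ip_simps flip: ip_def)
      ultimately show ?thesis using pos[OF p0] by (metis zero_less_mult_pos2)
    qed
    ultimately show ?thesis using t by simp
  qed
  have "ip c x = 0" if "\<And>g. g \<in> G \<Longrightarrow> real_mat g *v x = x" for x
    using c0(4)[OF that] by (simp add: c_def ip_simps)
  then show thesis using that c pos fixed by blast
qed

text \<open>
  For a rational functional \<open>f\<close>, the rational vector \<open>x = f c\<close> is fixed by \<open>G\<close>, hence \<open>(c, x) = 0\<close>.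
  As the form is rational, \<open>(x, x) = f (c, x) = 0\<close>, which forces \<open>x\<close> to be a multiple of \<open>c\<close>.
\<close>

lemma rational_invariant_isotropic_vector:
  obtains w s c where "s > 0" "real_vec w = s *\<^sub>R c" "c \<noteq> 0" "ip c c = 0"
    "\<And>p. p \<in> P \<Longrightarrow> ip p c > 0" "\<And>g. g \<in> G \<Longrightarrow> real_mat g *v c = c"
    "\<And>x. (\<And>g. g \<in> G \<Longrightarrow> real_mat g *v x = x) \<Longrightarrow> ip c x = 0"
proof -
  obtain c where c: "c \<noteq> 0" "ip c c = 0" "\<And>p. p \<in> P \<Longrightarrow> ip p c > 0"
    "\<And>g. g \<in> G \<Longrightarrow> real_mat g *v c = c"
    "\<And>x. (\<And>g. g \<in> G \<Longrightarrow> real_mat g *v x = x) \<Longrightarrow> ip c x = 0"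
    using invariant_isotropic_vector by metis
  obtain i0 where i0: "c $ i0 \<noteq> 0" using c(1) by (auto simp: vec_eq_iff)
  obtain f where f: "Modules.additive f" "\<And>y. f y \<in> \<rat>" "f (c $ i0) = 1"
    "\<And>q y. q \<in> \<rat> \<Longrightarrow> f (q * y) = q * f y"
    using rational_functional_nonzero_at[OF i0] by metis
  interpret f: Modules.additive f by (rule f(1))
  define x :: "real ^ 'n" where "x = (\<chi> i. f (c $ i))"
  have x: "x $ i = f (c $ i)" for i by (simp add: x_def)
  have "real_mat g *v x = x" if g: "g \<in> G" for g
  proof -
    have "(real_mat g *v x) $ i = x $ i" for i
    proof -
      have "(real_mat g *v x) $ i = (\<Sum>j\<in>UNIV. f (real_mat g $ i $ j * c $ j))"
        by (simp add: matrix_vector_mult_def x f(4) matrix_ext_def)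
      also have "\<dots> = f ((real_mat g *v c) $ i)" by (simp add: f.sum matrix_vector_mult_def)
      finally show ?thesis by (simp add: c(4)[OF g] x)
    qed
    then show ?thesis by (simp add: vec_eq_iff)
  qed
  then have cx: "ip c x = 0" by (rule c(5))
  have "ip x x = 0"
  proof -
    have rat: "(gram *v x) $ i \<in> \<rat>" for i
      using f(2) by (auto simp: matrix_vector_mult_def x gram_matrix_def intro!: Rats_sum Rats_mult)
    have "f (ip c x) = (\<Sum>i\<in>UNIV. f ((gram *v x) $ i * c $ i))"
      by (simp add: ip_def inner_vec_def f.sum mult.commute)
    also have "\<dots> = (\<Sum>i\<in>UNIV. (gram *v x) $ i * f (c $ i))" by (simp only: f(4)[OF rat])
    also have "\<dots> = ip x x" by (simp add: ip_def inner_vec_def x mult.commute)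
    finally show ?thesis using cx f.zero by simp
  qed
  with cx obtain t where t: "x = t *\<^sub>R c"
    using multiple_if_orthogonal_to_isotropic[OF c(1,2), of x] by auto
  have "t \<noteq> 0" using x[of i0] f(3) t by auto
  have "x $ i \<in> \<rat>" for i using f(2) by (simp add: x)
  then obtain d :: int and v :: "int ^ 'n" where d: "d > 0" "\<And>i. of_int (v $ i) = of_int d * x $ i"
    using common_denominator by metis
  obtain w where w: "\<phi> w = v" using coords_surj by blast
  have "real_vec w = (of_int d * t) *\<^sub>R c" using w d(2) by (simp add: vec_eq_iff t)
  then have "real_vec (if t > 0 then w else - w) = (of_int d * \<bar>t\<bar>) *\<^sub>R c"
    by (auto simp: real_vec_minus)
  moreover have "of_int d * \<bar>t\<bar> > 0" using d(1) \<open>t \<noteq> 0\<close> by simp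
  ultimately show thesis using that c by blast
qed

text \<open>
  Choose a lattice vector \<open>v\<close> on the ray whose coordinates have the least sum of absolute values. If
  \<open>t v\<close> is a lattice vector, so is \<open>(t - \<lfloor>t\<rfloor>) v\<close>; it is shorter than \<open>v\<close>, hence zero.
\<close>

lemma saturated_invariant_isotropic_lattice_vector:
  obtains v where "v \<noteq> 0" "b v v = 0" "\<And>p. p \<in> P \<Longrightarrow> ip p (real_vec v) > 0"
    "\<And>g. g \<in> G \<Longrightarrow> g v = v"
    "\<And>x. (\<And>g. g \<in> G \<Longrightarrow> real_mat g *v x = x) \<Longrightarrow> ip (real_vec v) x = 0"
    "\<And>x t. real_vec x = t *\<^sub>R real_vec v \<Longrightarrow> \<exists>k::int. real_vec x = of_int k *\<^sub>R real_vec v"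
proof -
  obtain w0 s0 c where w0: "s0 > 0" "real_vec w0 = s0 *\<^sub>R c" and c: "c \<noteq> 0" "ip c c = 0"
    "\<And>p. p \<in> P \<Longrightarrow> ip p c > 0" "\<And>g. g \<in> G \<Longrightarrow> real_mat g *v c = c"
    "\<And>x. (\<And>g. g \<in> G \<Longrightarrow> real_mat g *v x = x) \<Longrightarrow> ip c x = 0"
    using rational_invariant_isotropic_vector by metis
  define size1 where "size1 x = (\<Sum>i\<in>UNIV. \<bar>real_vec x $ i\<bar>)" for x
  have size1_nat: "size1 x = real (nat (\<Sum>i\<in>UNIV. \<bar>\<phi> x $ i\<bar>))" for x
    by (simp add: size1_def sum_nonneg)
  obtain v where "\<exists>s>0. real_vec v = s *\<^sub>R c"
    and least: "\<forall>y. (\<exists>s>0. real_vec y = s *\<^sub>R c) \<longrightarrow>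
      nat (\<Sum>i\<in>UNIV. \<bar>\<phi> v $ i\<bar>) \<le> nat (\<Sum>i\<in>UNIV. \<bar>\<phi> y $ i\<bar>)"
    using ex_has_least_nat[of "\<lambda>y. \<exists>s>0. real_vec y = s *\<^sub>R c" w0 "\<lambda>y. nat (\<Sum>i\<in>UNIV. \<bar>\<phi> y $ i\<bar>)"] w0
    by blast
  then obtain s where s: "s > 0" "real_vec v = s *\<^sub>R c" by blast
  have min: "size1 v \<le> size1 y" if "r > 0" "real_vec y = r *\<^sub>R c" for y r
    unfolding size1_nat of_nat_le_iff using least that by blast
  have v0: "real_vec v \<noteq> 0" using s c(1) by simp
  have "size1 v > 0"
  proof -
    obtain i where "real_vec v $ i \<noteq> 0" using v0 by (auto simp: vec_eq_iff)
    then have "0 < \<bar>real_vec v $ i\<bar>" by simp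
    also have "\<dots> \<le> size1 v" unfolding size1_def by (rule member_le_sum) auto
    finally show ?thesis .
  qed
  have sat: "\<exists>k::int. real_vec x = of_int k *\<^sub>R real_vec v" if x: "real_vec x = t *\<^sub>R real_vec v" for x t
  proof -
    define k where "k = \<lfloor>t\<rfloor>"
    define y where "y = x - v [^]\<^bsub>additive_group\<^esub> k"
    have y: "real_vec y = (t - of_int k) *\<^sub>R real_vec v"
      by (simp add: y_def real_vec_diff real_vec_int_pow x scaleR_diff_left)
    have "t - of_int k = 0"
    proof (rule ccontr)
      assume "t - of_int k \<noteq> 0"
      then have pos: "0 < t - of_int k" and lt: "t - of_int k < 1" by (auto simp: k_def) linarith+
      have "size1 v \<le> size1 y"
        by (rule min[of "(t - of_int k) * s"]) (use pos s y in simp_all)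
      moreover have "size1 y = (t - of_int k) * size1 v"
        using pos by (simp add: size1_def y abs_mult sum_distrib_left del: real_vec_nth)
      moreover have "(t - of_int k) * size1 v < 1 * size1 v"
        using lt \<open>size1 v > 0\<close> by (intro mult_strict_right_mono)
      ultimately show False by simp
    qed
    then show ?thesis using x by (intro exI[of _ k]) simp
  qed
  show thesis
  proof (rule that[OF _ _ _ _ _ sat])
    show "v \<noteq> 0" using v0 real_vec_zero by auto
    have "ip (real_vec v) (real_vec v) = 0" using c(2) by (simp add: s ip_simps)
    then show "b v v = 0" by (simp add: ip_real_vec)
    show "ip p (real_vec v) > 0" if "p \<in> P" for p using c(3)[OF that] s by (simp add: ip_simps)
    show "g v = v" if "g \<in> G" for g
    proof -
      have "real_vec (g v) = real_vec v"
        using that by (simp add: s c(4) matrix_vector_mult_scaleR flip: real_mat_real_vec[OF G_additive])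
      then show ?thesis by (simp add: real_vec_inject)
    qed
    show "ip (real_vec v) x = 0" if "\<And>g. g \<in> G \<Longrightarrow> real_mat g *v x = x" for x
      using c(5)[OF that] by (simp add: s ip_simps)
  qed
qed

text \<open>
  A fixed vector is orthogonal to \<open>v\<close>, and a frontier vector is isotropic; together these properties
  put it on the line of \<open>v\<close>.
\<close>

lemma fixed_boundary_vectors_ray:
  obtains v where "v \<noteq> 0" "b v v = 0" "\<And>g. g \<in> G \<Longrightarrow> g v = v"
    "\<And>x t. real_vec x = t *\<^sub>R real_vec v \<Longrightarrow> \<exists>k::int. real_vec x = of_int k *\<^sub>R real_vec v"
    "\<And>x. x \<in> fixed_boundary_vectors \<phi> P G \<longleftrightarrow> (\<exists>t>0. x = t *\<^sub>R real_vec v)"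
proof -
  obtain v where v: "v \<noteq> 0" "b v v = 0" "\<And>p. p \<in> P \<Longrightarrow> ip p (real_vec v) > 0"
    "\<And>g. g \<in> G \<Longrightarrow> g v = v"
    "\<And>x. (\<And>g. g \<in> G \<Longrightarrow> real_mat g *v x = x) \<Longrightarrow> ip (real_vec v) x = 0"
    "\<And>x t. real_vec x = t *\<^sub>R real_vec v \<Longrightarrow> \<exists>k::int. real_vec x = of_int k *\<^sub>R real_vec v"
    using saturated_invariant_isotropic_lattice_vector by metis
  have v0: "real_vec v \<noteq> 0" using v(1) by (metis real_vec_inject real_vec_zero)
  have iso: "ip (real_vec v) (real_vec v) = 0" by (simp add: ip_real_vec v(2))
  obtain p where p: "p \<in> P" using cone_nonempty by auto
  have gv: "real_mat g *v real_vec v = real_vec v" if "g \<in> G" for g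
    using that by (simp add: real_mat_real_vec G_additive v(4))
  have front: "t *\<^sub>R real_vec v \<in> frontier P" if "t > 0" for t
    using that v0 iso p v(3)[OF p] by (intro frontier_if_isotropic[of _ p]) (simp_all add: ip_simps)
  have mem: "x \<in> fixed_boundary_vectors \<phi> P G
      \<longleftrightarrow> x \<in> frontier P \<and> x \<noteq> 0 \<and> (\<forall>g\<in>G. real_mat g *v x = x)" for x
    by (auto simp: fixed_boundary_vectors_def map_ext_def)
  have "x \<in> fixed_boundary_vectors \<phi> P G \<longleftrightarrow> (\<exists>t>0. x = t *\<^sub>R real_vec v)" for x
  proof
    assume x: "x \<in> fixed_boundary_vectors \<phi> P G"
    then have "ip (real_vec v) x = 0" "ip x x = 0"
      using v(5) isotropic_if_frontier unfolding mem by blast+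
    then obtain t where t: "x = t *\<^sub>R real_vec v"
      using multiple_if_orthogonal_to_isotropic[OF v0 iso, of x] by auto
    moreover have "t > 0"
      using positive_multiple_if_frontier[OF _ v0, of x t] front[of 1] x t unfolding mem by simp
    ultimately show "\<exists>t>0. x = t *\<^sub>R real_vec v" by blast
  next
    assume "\<exists>t>0. x = t *\<^sub>R real_vec v"
    then show "x \<in> fixed_boundary_vectors \<phi> P G"
      unfolding mem using front v0 gv by (auto simp: matrix_vector_mult_scaleR)
  qed
  then show thesis using that v by blast
qed

lemma fixed_ray:
  "(\<exists>v. v \<in> fixed_boundary_vectors \<phi> P G) \<and>
   (\<exists>!R. \<exists>v\<in>fixed_boundary_vectors \<phi> P G. R = open_ray v) \<and>
   (\<exists>!v. primitive v \<and> real_vec v \<in> fixed_boundary_vectors \<phi> P G)"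
proof -
  obtain v where v: "v \<noteq> 0"
    "\<And>x t. real_vec x = t *\<^sub>R real_vec v \<Longrightarrow> \<exists>k::int. real_vec x = of_int k *\<^sub>R real_vec v"
    "\<And>x. x \<in> fixed_boundary_vectors \<phi> P G \<longleftrightarrow> (\<exists>t>0. x = t *\<^sub>R real_vec v)"
    using fixed_boundary_vectors_ray by metis
  have v0: "real_vec v \<noteq> 0" using v(1) by (metis real_vec_inject real_vec_zero)
  have mem: "real_vec v \<in> fixed_boundary_vectors \<phi> P G"
    by (rule v(3)[THEN iffD2]) (intro exI[of _ 1], simp)
  have ray: "open_ray x = open_ray (real_vec v)" if x: "x \<in> fixed_boundary_vectors \<phi> P G" for x
  proof -
    obtain t where t: "t > 0" "x = t *\<^sub>R real_vec v" using x v(3) by blast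
    have "\<exists>d>0. c *\<^sub>R real_vec v = d *\<^sub>R x" if "c > 0" for c :: real
      using t that by (intro exI[of _ "c / t"]) simp
    moreover have "\<exists>d>0. c *\<^sub>R x = d *\<^sub>R real_vec v" if "c > 0" for c :: real
      using t that by (intro exI[of _ "c * t"]) simp
    ultimately show ?thesis unfolding open_ray_def by blast
  qed
  have "\<exists>!w. primitive w \<and> real_vec w \<in> fixed_boundary_vectors \<phi> P G"
  proof (rule ex1I)
    show "primitive v \<and> real_vec v \<in> fixed_boundary_vectors \<phi> P G"
    proof
      show "primitive v" by (rule primitive_if_saturated[OF v(1)]) (rule v(2))
    qed (rule mem)
  next
    fix w assume w: "primitive w \<and> real_vec w \<in> fixed_boundary_vectors \<phi> P G"
    then obtain t where t: "t > 0" "real_vec w = t *\<^sub>R real_vec v" using v(3) by blast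
    then obtain k :: int where k: "real_vec w = of_int k *\<^sub>R real_vec v" using v(2) by blast
    then have "of_int k = t" using t v0 by simp
    then have "k > 0" using t(1) by simp
    obtain m :: int where "real_vec v = of_int m *\<^sub>R real_vec w"
      using primitive_imp_saturated k w by blast
    then have "real_vec v = of_int (m * k) *\<^sub>R real_vec v" using k by simp
    then have "of_int (m * k) *\<^sub>R real_vec v = 1 *\<^sub>R real_vec v" by simp
    then have "real_of_int (m * k) = 1" using v0 unfolding scaleR_cancel_right by simp
    then have "m * k = 1" by (metis of_int_eq_1_iff)
    then have "k = 1" using \<open>k > 0\<close> by (simp add: zmult_eq_1_iff)
    then show "w = v" using k by (simp add: real_vec_inject)
  qed
  then show ?thesis using mem ray by blast
qed

lemma free_abelian_finite_index:
  "\<exists>s. s + 2 \<le> CARD('n) \<and>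
     (\<exists>G\<^sub>0. G\<^sub>0 \<lhd> isometry_group\<lparr>carrier := G\<rparr> \<and>
       finite (rcosets\<^bsub>isometry_group\<lparr>carrier := G\<rparr>\<^esub> G\<^sub>0) \<and>
       isometry_group\<lparr>carrier := G\<^sub>0\<rparr> \<cong> free_Abelian_group {..<s}) \<and>
     almost_abelian (isometry_group\<lparr>carrier := G\<rparr>) s"
proof -
  obtain v where v: "v \<noteq> 0" "b v v = 0" "\<And>g. g \<in> G \<Longrightarrow> g v = v"
    "\<And>x t. real_vec x = t *\<^sub>R real_vec v \<Longrightarrow> \<exists>k::int. real_vec x = of_int k *\<^sub>R real_vec v"
    using fixed_boundary_vectors_ray by metis
  interpret fixed_isotropic_vector \<phi> b P G v
    by (intro fixed_isotropic_vector.intro isometry_subgroup_axioms fixed_isotropic_vector_axioms.intro v)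
  obtain s where s: "s + 2 \<le> CARD('n)" "isometry_group\<lparr>carrier := transvections\<rparr> \<cong> free_Abelian_group {..<s}"
    using free_abelian_transvections by blast
  have "almost_abelian group_G s"
    by (rule almost_abelian_if_free_abelian_normal_subgroup[OF group_group_G normal_transvections finite_index_transvections])
      (simp add: s)
  then show ?thesis using s normal_transvections finite_index_transvections by blast
qed

end

theorem theorem2p1:
  fixes \<phi> :: "'l::ab_group_add \<Rightarrow> int ^ 'n::finite"
    and b :: "'l \<Rightarrow> 'l \<Rightarrow> int"
    and P :: "(real ^ 'n) set"
    and G :: "('l \<Rightarrow> 'l) set"
  assumes "hyperbolic \<phi> b"
    and "is_positive_cone \<phi> b P"
    and "subgroup G (positive_isometry_group \<phi> b P)"
    and "infinite G"
    and "\<forall>g\<in>G. entropy \<phi> g = 0"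
  shows
    "((\<exists>v. v \<in> fixed_boundary_vectors \<phi> P G) \<and>
      (\<exists>!R. \<exists>v\<in>fixed_boundary_vectors \<phi> P G. R = open_ray v) \<and>
      (\<exists>!v::'l. primitive v \<and> scalar_ext \<phi> v \<in> fixed_boundary_vectors \<phi> P G)) \<and>
     (\<exists>s. s + 2 \<le> CARD('n) \<and>
       (\<exists>G\<^sub>0. G\<^sub>0 \<lhd> (positive_isometry_group \<phi> b P)\<lparr>carrier := G\<rparr> \<and>
             finite (rcosets\<^bsub>(positive_isometry_group \<phi> b P)\<lparr>carrier := G\<rparr>\<^esub> G\<^sub>0) \<and>
             (positive_isometry_group \<phi> b P)\<lparr>carrier := G\<^sub>0\<rparr> \<cong> free_Abelian_group {..<s}) \<and>
       almost_abelian ((positive_isometry_group \<phi> b P)\<lparr>carrier := G\<rparr>) s)"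
proof -
  have "is_lattice \<phi> b" using assms(1) by (simp add: hyperbolic_def)
  then interpret null_entropy_group \<phi> b P G
    using assms by (intro null_entropy_group.intro null_entropy_group_axioms.intro
        isometry_subgroup.intro isometry_subgroup_axioms.intro
        hyperbolic_lattice.intro hyperbolic_lattice_axioms.intro integral_lattice.intro) auto
  show ?thesis using fixed_ray free_abelian_finite_index by blast
qed

end
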